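(* Consider the event-triggered distributed estimator described in the context, and suppose: (i) the communication graph is connected, i.e. $\lambda_2(\mathcal{L})>0$; (ii) $G=\sum_{i=1}^N H_i^TH_i$ is full rank; (iii) there is $\epsilon_1>0$ with $\mathbb{E}\{\|V(t)\|^{2+\epsilon_1}\}<\infty$; (iv) the step sizes are $\alpha(t)=\frac{a}{(t+1)^{\tau_1}}$ and $\beta(t)=\frac{b}{(t+1)^{\tau_2}}$ with $a,b>0$, $0<\tau_2\le\tau_1\le 1$, and $\tau_1>\max\{\tau_2+\frac{1}{2+\epsilon_1},0.5\}$. Let $\rho_0=\min_{j\in\mathcal{V}}\rho_j$. If $\rho_0>\tau_1-\tau_2$, then for every $i\in\mathcal{V}$, $\mathbb{P}\big(\lim_{t\to\infty}x_i(t)=\theta\big)=1$.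
   Context: An unknown parameter $\theta\in\mathbb{R}^n$ is observed by $N$ agents $\mathcal{V}=\{1,\dots,N\}$ via $y_i(t)=H_i\theta+v_i(t)$, $t=0,1,2,\dots$, where $H_i\in\mathbb{R}^{m_i\times n}$ is known and the noise $v_i(t)\in\mathbb{R}^{m_i}$ is zero mean with covariance $R_i$. The stacked noise $V(t)=[v_1(t)^T,\dots,v_N(t)^T]^T$ is i.i.d. over time (noises of different agents at the same time may be correlated). Agents communicate over an undirected graph without self-loops with adjacency matrix $\mathcal{A}=[a_{ij}]\in\{0,1\}^{N\times N}$, neighbor sets $\mathcal{N}_i=\{j: a_{ij}=1\}$, degree matrix $\mathcal{D}$ and Laplacian $\mathcal{L}=\mathcal{D}-\mathcal{A}$. Each agent $i$ has a threshold exponent $\rho_i>0$. Agent $i$ keeps an estimate $x_i(t)\in\mathbb{R}^n$ (arbitrary deterministic initial value $x_i(0)$, which is the first transmitted value). Let $t_k^i$ be the latest triggering (transmission) time of agent $i$. At time $t$, agent $i$ triggers (broadcasts $x_i(t)$ to its neighbors, which then becomes its latest transmitted value) iff $\|x_i(t)-x_i(t_k^i)\|>\frac{1}{(t+1)^{\rho_i}}$. Denoting by $x_j(t_k^j)$ the latest value transmitted by agent $j$ up to and including time $t$, the estimator is $x_i(t+1)=x_i(t)+\alpha(t)H_i^T\big(y_i(t)-H_ix_i(t)\big)+\beta(t)\sum_{j\in\mathcal{N}_i}\big(x_j(t_k^j)-x_i(t)\big)$. *)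

theory Defs
  imports "HOL-Probability.Probability"
begin

text \<open>Agents are indexed by 0..N-1.  Agent i has observation dimension m i;
  H i k j is the (k,j) entry of H_i (k < m i, j ranges over the index type 'n of R^n).\<close>

definition Hmul :: "(nat \<Rightarrow> nat \<Rightarrow> 'n::finite \<Rightarrow> real) \<Rightarrow> nat \<Rightarrow> real^'n \<Rightarrow> (nat \<Rightarrow> real)" where
  "Hmul H i x = (\<lambda>k. \<Sum>j\<in>UNIV. H i k j * x $ j)"

definition HTmul :: "(nat \<Rightarrow> nat \<Rightarrow> 'n::finite \<Rightarrow> real) \<Rightarrow> (nat \<Rightarrow> nat) \<Rightarrow> nat \<Rightarrow> (nat \<Rightarrow> real) \<Rightarrow> real^'n" where
  "HTmul H m i w = (\<chi> j. \<Sum>k<m i. H i k j * w k)"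

definition Gram :: "nat \<Rightarrow> (nat \<Rightarrow> nat \<Rightarrow> 'n::finite \<Rightarrow> real) \<Rightarrow> (nat \<Rightarrow> nat) \<Rightarrow> real^'n^'n" where
  "Gram N H m = (\<chi> j l. \<Sum>i<N. \<Sum>k<m i. H i k j * H i k l)"

definition undirected_graph :: "nat \<Rightarrow> (nat \<Rightarrow> nat \<Rightarrow> bool) \<Rightarrow> bool" where
  "undirected_graph N A \<longleftrightarrow> (\<forall>i j. A i j \<longrightarrow> i < N \<and> j < N) \<and> (\<forall>i j. A i j = A j i) \<and> (\<forall>i. \<not> A i i)"

definition graph_connected :: "nat \<Rightarrow> (nat \<Rightarrow> nat \<Rightarrow> bool) \<Rightarrow> bool" where
  "graph_connected N A \<longleftrightarrow> (\<forall>i<N. \<forall>j<N. A\<^sup>*\<^sup>* i j)"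

definition neighbors :: "nat \<Rightarrow> (nat \<Rightarrow> nat \<Rightarrow> bool) \<Rightarrow> nat \<Rightarrow> nat set" where
  "neighbors N A i = {j. j < N \<and> A i j}"

text \<open>State of the estimator at time t: (x(t), xhat(t)) where xhat t i is the latest value
  transmitted by agent i up to and including time t.  obs t i k is the k-th entry of y_i(t).\<close>
fun est_state :: "nat \<Rightarrow> (nat \<Rightarrow> nat \<Rightarrow> bool) \<Rightarrow> (nat \<Rightarrow> nat \<Rightarrow> 'n::finite \<Rightarrow> real) \<Rightarrow> (nat \<Rightarrow> nat)
   \<Rightarrow> (nat \<Rightarrow> real) \<Rightarrow> (nat \<Rightarrow> real) \<Rightarrow> (nat \<Rightarrow> real) \<Rightarrow> (nat \<Rightarrow> real^'n)
   \<Rightarrow> (nat \<Rightarrow> nat \<Rightarrow> nat \<Rightarrow> real) \<Rightarrow> nat \<Rightarrow> (nat \<Rightarrow> real^'n) \<times> (nat \<Rightarrow> real^'n)" where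
  "est_state N A H m \<alpha> \<beta> \<rho> x0 obs 0 = (x0, x0)"
| "est_state N A H m \<alpha> \<beta> \<rho> x0 obs (Suc t) =
     (let (x, xh) = est_state N A H m \<alpha> \<beta> \<rho> x0 obs t;
          x' = (\<lambda>i. x i + \<alpha> t *\<^sub>R HTmul H m i (\<lambda>k. obs t i k - Hmul H i (x i) k)
                      + \<beta> t *\<^sub>R (\<Sum>j\<in>neighbors N A i. xh j - x i));
          xh' = (\<lambda>i. if norm (x' i - xh i) > 1 / (real (Suc t) + 1) powr \<rho> i then x' i else xh i)
      in (x', xh'))"

definition est :: "nat \<Rightarrow> (nat \<Rightarrow> nat \<Rightarrow> bool) \<Rightarrow> (nat \<Rightarrow> nat \<Rightarrow> 'n::finite \<Rightarrow> real) \<Rightarrow> (nat \<Rightarrow> nat)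
   \<Rightarrow> (nat \<Rightarrow> real) \<Rightarrow> (nat \<Rightarrow> real) \<Rightarrow> (nat \<Rightarrow> real) \<Rightarrow> (nat \<Rightarrow> real^'n)
   \<Rightarrow> (nat \<Rightarrow> nat \<Rightarrow> nat \<Rightarrow> real) \<Rightarrow> nat \<Rightarrow> nat \<Rightarrow> real^'n" where
  "est N A H m \<alpha> \<beta> \<rho> x0 obs t i = fst (est_state N A H m \<alpha> \<beta> \<rho> x0 obs t) i"

definition noise_idx :: "nat \<Rightarrow> (nat \<Rightarrow> nat) \<Rightarrow> (nat \<times> nat) set" where
  "noise_idx N m = Sigma {..<N} (\<lambda>i. {..<m i})"

definition stacked :: "nat \<Rightarrow> (nat \<Rightarrow> nat) \<Rightarrow> (nat \<Rightarrow> nat \<Rightarrow> 'w \<Rightarrow> real) \<Rightarrow> 'w \<Rightarrow> (nat \<times> nat \<Rightarrow> real)" where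
  "stacked N m v \<omega> = restrict (\<lambda>(i,k). v i k \<omega>) (noise_idx N m)"

definition stacked_norm :: "nat \<Rightarrow> (nat \<Rightarrow> nat) \<Rightarrow> (nat \<Rightarrow> nat \<Rightarrow> 'w \<Rightarrow> real) \<Rightarrow> 'w \<Rightarrow> real" where
  "stacked_norm N m v \<omega> = sqrt (\<Sum>(i,k)\<in>noise_idx N m. (v i k \<omega>)\<^sup>2)"

end

theory Submission
  imports Defs
begin

text \<open>
  The error \<open>e = x - \<theta>\<close> satisfies \<open>e(t+1) = (I - K\<^sub>t) e(t) + \<alpha>\<^sub>t w(t) + \<beta>\<^sub>t d(t)\<close>, where
  \<open>K\<^sub>t = \<beta>\<^sub>t L + \<alpha>\<^sub>t diag(H\<^sub>i\<^sup>T H\<^sub>i)\<close>, \<open>w\<close> is the noise and \<open>d\<close> the effect of the trigger gaps, of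
  size \<open>O(t powr -\<rho>\<^sub>0)\<close>. Connectivity and the rank condition make \<open>(b/a) L + diag(H\<^sub>i\<^sup>T H\<^sub>i)\<close> positive
  definite, and \<open>\<beta>\<^sub>t \<ge> (b/a) \<alpha>\<^sub>t\<close>, so that for large \<open>t\<close> the map \<open>I - K\<^sub>t\<close> contracts the squared norm
  by the factor \<open>1 - c \<alpha>\<^sub>t\<close>. Split \<open>e = p + q\<close>, where \<open>p\<close> is driven by the noise only and \<open>q\<close> by the
  gaps only. As \<open>\<rho>\<^sub>0 > \<tau>\<^sub>1 - \<tau>\<^sub>2\<close>, the forcing of \<open>q\<close> is \<open>o(\<alpha>\<^sub>t)\<close>, hence \<open>q \<rightarrow> 0\<close> on every path, because
  \<open>\<Sum>\<alpha>\<^sub>t = \<infinity>\<close>. For \<open>p\<close>, the same scalar recursion gives \<open>E |p|\<^sup>2 \<rightarrow> 0\<close>, and \<open>|p|\<^sup>2\<close> is a nonnegative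
  supermartingale up to the summable errors \<open>O(\<alpha>\<^sub>t\<^sup>2)\<close>, so that Doob's maximal inequality started at a
  late time turns convergence of the means into almost sure convergence.
\<close>

section \<open>Scalar recursions and near-supermartingales\<close>

text \<open>As soon as \<open>\<bar>\<eta> t\<bar> < r / 2\<close>, the perturbation can only pull
  \<open>u\<close> towards levels below \<open>r / 2\<close>. The excess of \<open>u\<close> over
  \<open>r / 2\<close> is then multiplied by at most \<open>1 - a t \<le> exp (- a t)\<close> in
  each step, and divergence of the series of \<open>a\<close> drives the product of these factors to
  0.\<close>

lemma perturbed_contraction_tendsto_zero:
  fixes u a \<eta> :: "nat \<Rightarrow> real"
  assumes nonneg: "\<And>t. 0 \<le> u t"
    and step: "\<And>t. T \<le> t \<Longrightarrow> u (Suc t) \<le> (1 - a t) * u t + a t * \<eta> t"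
    and a: "\<And>t. T \<le> t \<Longrightarrow> 0 \<le> a t" "\<And>t. T \<le> t \<Longrightarrow> a t \<le> 1"
    and diverges: "\<not> summable a"
    and \<eta>: "\<eta> \<longlonglongrightarrow> 0"
  shows "u \<longlonglongrightarrow> 0"
proof (rule LIMSEQ_I)
  fix r :: real assume r: "0 < r"
  obtain T' where T': "\<And>t. t \<ge> T' \<Longrightarrow> \<bar>\<eta> t\<bar> < r / 2"
    using LIMSEQ_D[OF \<eta>, of "r/2"] r by auto
  define S where "S = max T T'"
  \<comment> \<open>The initial excess may be negative. Its positive part keeps the right-hand side
    nonnegative, as replacing \<open>1 - a\<close> by \<open>exp (- a)\<close> requires.\<close>
  define D where "D = max 0 (u S - r / 2)"
  have bound: "u (S + n) - r / 2 \<le> D * exp (- (\<Sum>i<n. a (S + i)))" for n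
  proof (induction n)
    case 0 show ?case by (simp add: D_def)
  next
    case (Suc n)
    have S: "T \<le> S + n" "T' \<le> S + n" by (auto simp: S_def)
    have "a (S + n) * \<eta> (S + n) \<le> a (S + n) * (r / 2)"
      using T'[OF S(2)] a(1)[OF S(1)] by (intro mult_left_mono) auto
    then have "u (S + Suc n) - r / 2 \<le> (1 - a (S + n)) * (u (S + n) - r / 2)"
      using step[OF S(1)] by (simp add: algebra_simps)
    also have "\<dots> \<le> (1 - a (S + n)) * (D * exp (- (\<Sum>i<n. a (S + i))))"
      using Suc a(2)[OF S(1)] by (intro mult_left_mono) auto
    also have "\<dots> \<le> exp (- a (S + n)) * (D * exp (- (\<Sum>i<n. a (S + i))))"
      using exp_ge_add_one_self[of "- a (S + n)"] by (intro mult_right_mono) (auto simp: D_def)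
    also have "\<dots> = D * exp (- (\<Sum>i<Suc n. a (S + i)))"
      by (simp add: exp_add exp_diff exp_minus field_simps)
    finally show ?case .
  qed
  have "\<not> summable (\<lambda>i. a (S + i))"
    using diverges summable_iff_shift[of a S] by (simp add: add.commute)
  then have "\<exists>n0. \<forall>n\<ge>n0. D * exp (- (\<Sum>i<n. a (S + i))) < r / 2"
  proof -
    assume ns: "\<not> summable (\<lambda>i. a (S + i))"
    have nn: "0 \<le> a (S + i)" for i using a(1)[of "S + i"] by (auto simp: S_def)
    \<comment> \<open>Chosen so that
      \<open>D * exp (- ln K) = D * r / (2 * (D + 1)) < r / 2\<close>; the summand 1 makes the
      inequality strict and also covers \<open>D = 0\<close>.\<close>
    define K where "K = 2 * (D + 1) / r"
    have "D \<ge> 0" by (simp add: D_def)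
    then have K: "K > 0" unfolding K_def using r by (intro divide_pos_pos) auto
    have "\<exists>n. (\<Sum>i<n. a (S + i)) > ln K"
    proof (rule ccontr)
      assume "\<nexists>n. (\<Sum>i<n. a (S + i)) > ln K"
      then have "summable (\<lambda>i. a (S + i))"
        by (intro summableI_nonneg_bounded[where x = "ln K"] nn) (auto simp: not_less)
      with ns show False by simp
    qed
    then obtain n0 where n0: "(\<Sum>i<n0. a (S + i)) > ln K" by blast
    have "D * exp (- (\<Sum>i<n. a (S + i))) < r / 2" if "n \<ge> n0" for n
    proof -
      have "(\<Sum>i<n0. a (S + i)) \<le> (\<Sum>i<n. a (S + i))"
        using that nn by (intro sum_mono2) auto
      then have "exp (- (\<Sum>i<n. a (S + i))) \<le> exp (- ln K)" using n0 by simp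
      also have "\<dots> = r / (2 * (D + 1))" using K by (simp add: exp_minus K_def)
      finally have "D * exp (- (\<Sum>i<n. a (S + i))) \<le> D * (r / (2 * (D + 1)))"
        by (intro mult_left_mono) (auto simp: D_def)
      also have "\<dots> < r / 2" using r by (simp add: field_simps D_def)
      finally show ?thesis .
    qed
    then show ?thesis by blast
  qed
  then obtain n0 where n0: "\<And>n. n \<ge> n0 \<Longrightarrow> D * exp (- (\<Sum>i<n. a (S + i))) < r / 2" by blast
  have "norm (u n - 0) < r" if n: "n \<ge> S + n0" for n
  proof -
    have "u (S + (n - S)) - r / 2 < r / 2"
      using bound[of "n - S"] n0[of "n - S"] n by linarith
    then show ?thesis using nonneg[of n] n by simp
  qed
  then show "\<exists>no. \<forall>n\<ge>no. norm (u n - 0) < r" by blast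
qed

text \<open>Doob's maximal inequality by stopping at the first passage above \<open>c\<close>. The
  supermartingale property is only required in integrated form, on the event of having stayed below
  \<open>c\<close> so far, so no conditional expectation enters; \<open>s t\<close> is the allowed
  defect.\<close>

lemma (in prob_space) near_supermartingale_maximal_inequality:
  fixes V :: "nat \<Rightarrow> 'a \<Rightarrow> real"
  assumes int: "\<And>t. integrable M (V t)"
    and nonneg: "\<And>t \<omega>. 0 \<le> V t \<omega>"
    and step: "\<And>t. t0 \<le> t \<Longrightarrow>
      (\<integral>\<omega>. indicator {\<omega>\<in>space M. \<forall>s\<in>{t0..t}. V s \<omega> < c} \<omega> * V (Suc t) \<omega> \<partial>M)
      \<le> (\<integral>\<omega>. indicator {\<omega>\<in>space M. \<forall>s\<in>{t0..t}. V s \<omega> < c} \<omega> * V t \<omega> \<partial>M) + s t"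
    and c: "c \<ge> 0"
  shows "c * prob {\<omega>\<in>space M. \<exists>s\<in>{t0..<t0 + n}. V s \<omega> \<ge> c}
    \<le> expectation (V t0) + (\<Sum>i<n. s (t0 + i))"
proof -
  have [measurable]: "V t \<in> borel_measurable M" for t using int by auto
  define B where "B n = {\<omega>\<in>space M. \<forall>s\<in>{t0..<t0 + n}. V s \<omega> < c}" for n
  define E where "E n = {\<omega>\<in>space M. \<exists>s\<in>{t0..<t0 + n}. V s \<omega> \<ge> c}" for n
  have [measurable]: "B n \<in> sets M" "E n \<in> sets M" for n
    unfolding B_def E_def by measurable
  have integ: "integrable M (\<lambda>\<omega>. indicator (B n) \<omega> * V t \<omega>)" for n t
    using integrable_mult_indicator[OF \<open>B n \<in> sets M\<close> int[of t]] by simp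
  have integE: "integrable M (\<lambda>\<omega>. c * indicator (E n) \<omega>)" for n
    by (intro integrable_mult_right) (simp add: integrable_indicator_iff emeasure_finite less_top[symmetric])
  \<comment> \<open>\<open>B n\<close> and \<open>E n\<close> split the space into the paths still
    below \<open>c\<close> before time \<open>t0 + n\<close> and those that have already crossed. Up
    to the defects, the mass on \<open>B n\<close> plus \<open>c\<close> times the crossed
    probability never increases.\<close>
  have inv: "(\<integral>\<omega>. indicator (B n) \<omega> * V (t0 + n) \<omega> \<partial>M) + c * prob (E n)
    \<le> expectation (V t0) + (\<Sum>i<n. s (t0 + i))" for n
  proof (induction n)
    case 0
    have "(\<integral>\<omega>. indicator (B 0) \<omega> * V t0 \<omega> \<partial>M) = expectation (V t0)"
      by (intro Bochner_Integration.integral_cong) (auto simp: B_def)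
    then show ?case by (simp add: E_def)
  next
    case (Suc n)
    have iv: "{t0..<t0 + Suc n} = {t0..t0 + n}" by auto
    have "(\<integral>\<omega>. indicator (B (Suc n)) \<omega> * V (t0 + Suc n) \<omega> \<partial>M)
        \<le> (\<integral>\<omega>. indicator (B (Suc n)) \<omega> * V (t0 + n) \<omega> \<partial>M) + s (t0 + n)"
      using step[of "t0 + n"] unfolding B_def iv by simp
    moreover have "(\<integral>\<omega>. indicator (B (Suc n)) \<omega> * V (t0 + n) \<omega> \<partial>M) + c * prob (E (Suc n))
        \<le> (\<integral>\<omega>. indicator (B n) \<omega> * V (t0 + n) \<omega> \<partial>M) + c * prob (E n)"
    proof -
      have "(\<integral>\<omega>. indicator (B (Suc n)) \<omega> * V (t0 + n) \<omega> + c * indicator (E (Suc n)) \<omega> \<partial>M)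
        \<le> (\<integral>\<omega>. indicator (B n) \<omega> * V (t0 + n) \<omega> + c * indicator (E n) \<omega> \<partial>M)"
      proof (intro integral_mono Bochner_Integration.integrable_add integ integE)
        fix \<omega> assume \<omega>: "\<omega> \<in> space M"
        show "indicator (B (Suc n)) \<omega> * V (t0 + n) \<omega> + c * indicator (E (Suc n)) \<omega>
          \<le> indicator (B n) \<omega> * V (t0 + n) \<omega> + c * indicator (E n) \<omega>"
        \<comment> \<open>A path below \<open>c\<close> at time \<open>t0 + n\<close> keeps its
          class. A path at or above \<open>c\<close> ends up in \<open>E (Suc n)\<close>; if it was
          in \<open>B n\<close>, its value, at least \<open>c\<close>, pays for the move.\<close>
        proof (cases "V (t0 + n) \<omega> < c")
          case True
          then have "\<omega> \<in> B (Suc n) \<longleftrightarrow> \<omega> \<in> B n" "\<omega> \<in> E (Suc n) \<longleftrightarrow> \<omega> \<in> E n"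
            unfolding B_def E_def by (force simp: less_Suc_eq)+
          then show ?thesis by (auto simp: indicator_def)
        next
          case False
          then have "\<omega> \<notin> B (Suc n)" "\<omega> \<in> E (Suc n)" "\<omega> \<in> B n \<or> \<omega> \<in> E n"
            using \<omega> unfolding B_def E_def by (auto simp: not_less)
          then show ?thesis using False nonneg[of "t0 + n" \<omega>] c
            by (auto simp: indicator_def)
        qed
      qed
      then show ?thesis
        by (simp add: Bochner_Integration.integral_add[OF integ integE])
    qed
    ultimately show ?case using Suc by simp
  qed
  have "0 \<le> (\<integral>\<omega>. indicator (B n) \<omega> * V (t0 + n) \<omega> \<partial>M)"
    by (intro integral_nonneg_AE) (auto simp: nonneg)
  then show ?thesis using inv[of n] by (simp add: E_def)
qed

text \<open>The maximal inequality started at \<open>t0\<close> bounds the probability of ever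
  exceeding \<open>c\<close> after \<open>t0\<close> by the mean at \<open>t0\<close> plus the tail
  of the defects, divided by \<open>c\<close>. Both terms vanish as \<open>t0\<close> grows, so
  exceeding \<open>c\<close> infinitely often has probability 0; then \<open>c\<close> runs through
  a null sequence.\<close>

lemma (in prob_space) near_supermartingale_AE_tendsto_zero:
  fixes V :: "nat \<Rightarrow> 'a \<Rightarrow> real"
  assumes int: "\<And>t. integrable M (V t)"
    and nonneg: "\<And>t \<omega>. 0 \<le> V t \<omega>"
    and step: "\<And>t0 t c. t0 \<le> t \<Longrightarrow>
      (\<integral>\<omega>. indicator {\<omega>\<in>space M. \<forall>s\<in>{t0..t}. V s \<omega> < c} \<omega> * V (Suc t) \<omega> \<partial>M)
      \<le> (\<integral>\<omega>. indicator {\<omega>\<in>space M. \<forall>s\<in>{t0..t}. V s \<omega> < c} \<omega> * V t \<omega> \<partial>M) + s t"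
    and s: "summable s" "\<And>t. 0 \<le> s t"
    and mean: "(\<lambda>t. expectation (V t)) \<longlonglongrightarrow> 0"
  shows "AE \<omega> in M. (\<lambda>t. V t \<omega>) \<longlonglongrightarrow> 0"
proof -
  have [measurable]: "V t \<in> borel_measurable M" for t using int by auto
  have ev: "AE \<omega> in M. \<exists>t0. \<forall>t\<ge>t0. V t \<omega> < c" if c: "c > 0" for c
  proof -
    define E where "E t0 n = {\<omega>\<in>space M. \<exists>s\<in>{t0..<t0 + n}. V s \<omega> \<ge> c}" for t0 n :: nat
    define F where "F t0 = {\<omega>\<in>space M. \<exists>s\<ge>t0. V s \<omega> \<ge> c}" for t0 :: nat
    have [measurable]: "E t0 n \<in> sets M" "F t0 \<in> sets M" for t0 n
      unfolding E_def F_def by measurable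
    \<comment> \<open>This bound holds for every horizon \<open>n\<close>, so continuity from below
      carries it over to the infinite horizon event \<open>F t0\<close>.\<close>
    define r where "r t0 = (expectation (V t0) + (\<Sum>i. s (i + t0))) / c" for t0
    have F: "prob (F t0) \<le> r t0" for t0
    proof -
      have "(\<lambda>n. prob (E t0 n)) \<longlonglongrightarrow> prob (\<Union>n. E t0 n)"
        by (intro finite_Lim_measure_incseq) (auto simp: incseq_def E_def)
      moreover have "(\<Union>n. E t0 n) = F t0"
      proof -
        have "\<omega> \<in> (\<Union>n. E t0 n)" if "\<omega> \<in> F t0" for \<omega>
        proof -
          from that obtain q where "q \<ge> t0" "V q \<omega> \<ge> c" "\<omega> \<in> space M" by (auto simp: F_def)
          then have "\<omega> \<in> E t0 (Suc (q - t0))" by (auto simp: E_def intro!: bexI[of _ q])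
          then show ?thesis by blast
        qed
        moreover have "(\<Union>n. E t0 n) \<subseteq> F t0" by (auto simp: E_def F_def)
        ultimately show ?thesis by blast
      qed
      moreover have "prob (E t0 n) \<le> r t0" for n
      proof -
        have "c * prob (E t0 n) \<le> expectation (V t0) + (\<Sum>i<n. s (t0 + i))"
          unfolding E_def by (rule near_supermartingale_maximal_inequality) (use int nonneg step c in auto)
        also have "(\<Sum>i<n. s (t0 + i)) \<le> (\<Sum>i. s (i + t0))"
          using sum_le_suminf[OF summable_ignore_initial_segment[OF s(1), of t0], of "{..<n}"] s(2)
          by (simp add: add.commute)
        finally show ?thesis using c by (simp add: r_def field_simps)
      qed
      ultimately show ?thesis by (metis LIMSEQ_le_const2)
    qed
    have "r \<longlonglongrightarrow> (0 + 0) / c"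
      unfolding r_def using c by (intro tendsto_intros mean suminf_exist_split2 s(1)) auto
    then have r: "r \<longlonglongrightarrow> 0" by simp
    have "prob (\<Inter>t0. F t0) \<le> r t" for t
      by (rule order_trans[OF _ F]) (intro finite_measure_mono; auto)
    then have "prob (\<Inter>t0. F t0) \<le> 0"
      using r by (metis LIMSEQ_le_const)
    then have "prob (\<Inter>t0. F t0) = 0" by (simp add: antisym)
    then have "(\<Inter>t0. F t0) \<in> null_sets M"
      by (intro null_setsI) (auto simp: emeasure_eq_measure)
    from AE_not_in[OF this] show ?thesis
    proof (rule AE_mp, intro AE_I2 impI)
      fix \<omega> assume "\<omega> \<in> space M" "\<omega> \<notin> (\<Inter>t0. F t0)"
      then obtain t0 where "\<omega> \<in> space M" "\<omega> \<notin> F t0" by blast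
      then have "\<forall>t\<ge>t0. V t \<omega> < c" unfolding F_def mem_Collect_eq by (meson not_le)
      then show "\<exists>t0. \<forall>t\<ge>t0. V t \<omega> < c" by blast
    qed
  qed
  have "AE \<omega> in M. \<forall>n. \<exists>t0. \<forall>t\<ge>t0. V t \<omega> < inverse (real (Suc n))"
    unfolding AE_all_countable by (intro allI ev) simp
  then show ?thesis
  proof (rule AE_mp, intro AE_I2 impI)
    fix \<omega> assume *: "\<forall>n. \<exists>t0. \<forall>t\<ge>t0. V t \<omega> < inverse (real (Suc n))"
    show "(\<lambda>t. V t \<omega>) \<longlonglongrightarrow> 0"
    proof (rule LIMSEQ_I)
      fix r :: real assume "0 < r"
      then obtain n where "inverse (real (Suc n)) < r" using reals_Archimedean by blast
      moreover obtain t0 where "\<forall>t\<ge>t0. V t \<omega> < inverse (real (Suc n))" using * by blast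
      ultimately show "\<exists>no. \<forall>t\<ge>no. norm (V t \<omega> - 0) < r"
        using nonneg by (intro exI[of _ t0]) (auto intro: less_trans)
    qed
  qed
qed

section \<open>Contraction of the mean dynamics\<close>

definition obs_row :: "(nat \<Rightarrow> nat \<Rightarrow> 'n::finite \<Rightarrow> real) \<Rightarrow> nat \<Rightarrow> nat \<Rightarrow> real^'n" where
  "obs_row H i k = (\<chi> j. H i k j)"

lemma Hmul_eq_inner: "Hmul H i x k = obs_row H i k \<bullet> x"
  by (simp add: Hmul_def obs_row_def inner_vec_def)

lemma HTmul_eq_sum: "HTmul H m i w = (\<Sum>k<m i. w k *\<^sub>R obs_row H i k)"
  by (simp add: HTmul_def obs_row_def vec_eq_iff mult.commute)

lemma Gram_mult_eq_sum:
  "Gram N H m *v x = (\<Sum>i<N. \<Sum>k<m i. (obs_row H i k \<bullet> x) *\<^sub>R obs_row H i k)"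
proof -
  have "(Gram N H m *v x) $ j = (\<Sum>i<N. \<Sum>k<m i. (obs_row H i k \<bullet> x) *\<^sub>R obs_row H i k) $ j" for j
  proof -
    have "(Gram N H m *v x) $ j = (\<Sum>l\<in>UNIV. \<Sum>i<N. \<Sum>k<m i. H i k j * H i k l * x $ l)"
      by (simp add: matrix_vector_mult_def Gram_def sum_distrib_right)
    also have "\<dots> = (\<Sum>i<N. \<Sum>k<m i. \<Sum>l\<in>UNIV. H i k j * H i k l * x $ l)"
      by (subst sum.swap, intro sum.cong refl, rule sum.swap)
    also have "\<dots> = (\<Sum>i<N. \<Sum>k<m i. (\<Sum>l\<in>UNIV. H i k l * x $ l) * H i k j)"
      by (intro sum.cong refl) (simp add: sum_distrib_left sum_distrib_right mult_ac)
    finally show ?thesis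
      by (simp add: obs_row_def inner_vec_def)
  qed
  then show ?thesis by (simp add: vec_eq_iff)
qed

section \<open>Quadratic forms of the observations and of the graph\<close>

definition obs_energy :: "nat \<Rightarrow> (nat \<Rightarrow> nat \<Rightarrow> 'n::finite \<Rightarrow> real) \<Rightarrow> (nat \<Rightarrow> nat) \<Rightarrow> (nat \<Rightarrow> real^'n) \<Rightarrow> real" where
  "obs_energy N H m e = (\<Sum>i<N. \<Sum>k<m i. (obs_row H i k \<bullet> e i)\<^sup>2)"

text \<open>Every edge of an undirected graph is counted in both directions, so this is twice the
  Laplacian quadratic form.\<close>

definition graph_energy :: "nat \<Rightarrow> (nat \<Rightarrow> nat \<Rightarrow> bool) \<Rightarrow> (nat \<Rightarrow> real^'n::finite) \<Rightarrow> real" where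
  "graph_energy N A e = (\<Sum>i<N. \<Sum>j\<in>neighbors N A i. (norm (e i - e j))\<^sup>2)"

text \<open>Block \<open>i\<close> of \<open>K\<^sub>t e\<close>, for step sizes \<alpha> and
  \<beta>: the first sum is \<open>H\<^sub>i\<^sup>T H\<^sub>i e\<^sub>i\<close>, the second is the
  Laplacian applied to \<open>e\<close>.\<close>

definition drift :: "nat \<Rightarrow> (nat \<Rightarrow> nat \<Rightarrow> bool) \<Rightarrow> (nat \<Rightarrow> nat \<Rightarrow> 'n::finite \<Rightarrow> real) \<Rightarrow> (nat \<Rightarrow> nat)
   \<Rightarrow> real \<Rightarrow> real \<Rightarrow> (nat \<Rightarrow> real^'n) \<Rightarrow> nat \<Rightarrow> real^'n" where
  "drift N A H m \<alpha> \<beta> e i =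
     \<alpha> *\<^sub>R (\<Sum>k<m i. (obs_row H i k \<bullet> e i) *\<^sub>R obs_row H i k) + \<beta> *\<^sub>R (\<Sum>j\<in>neighbors N A i. e i - e j)"

lemma finite_neighbors [simp]: "finite (neighbors N A i)"
  by (simp add: neighbors_def)

lemma neighbors_less: "j \<in> neighbors N A i \<Longrightarrow> j < N"
  by (simp add: neighbors_def)

lemma obs_energy_nonneg: "0 \<le> obs_energy N H m e"
  by (simp add: obs_energy_def sum_nonneg)

lemma graph_energy_nonneg: "0 \<le> graph_energy N A e"
  by (simp add: graph_energy_def sum_nonneg)

lemma sum_neighbors_swap:
  assumes "undirected_graph N A"
  shows "(\<Sum>i<N. \<Sum>j\<in>neighbors N A i. f i j) = (\<Sum>i<N. \<Sum>j\<in>neighbors N A i. f j i)"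
proof -
  have nb: "neighbors N A i = {j. j \<in> {..<N} \<and> A i j}" "neighbors N A i = {j. j \<in> {..<N} \<and> A j i}" for i
    using assms by (auto simp: neighbors_def undirected_graph_def)
  have "(\<Sum>i<N. \<Sum>j\<in>neighbors N A i. f i j) = (\<Sum>i<N. \<Sum>j | j \<in> {..<N} \<and> A i j. f i j)"
    by (simp only: nb(1))
  also have "\<dots> = (\<Sum>j<N. \<Sum>i | i \<in> {..<N} \<and> A i j. f i j)"
    by (rule sum.swap_restrict) auto
  finally show ?thesis by (simp only: nb(2))
qed

text \<open>Symmetry of the graph pairs \<open>e i \<bullet> (e i - e j)\<close> with
  \<open>e j \<bullet> (e j - e i)\<close>, and the two add up to a square; this is the source of
  the factor 1/2.\<close>

lemma inner_drift:
  assumes "undirected_graph N A"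
  shows "(\<Sum>i<N. e i \<bullet> drift N A H m \<alpha> \<beta> e i) = \<alpha> * obs_energy N H m e + \<beta> / 2 * graph_energy N A e"
proof -
  define f where "f i j = e i \<bullet> (e i - e j)" for i j
  have "2 * (\<Sum>i<N. \<Sum>j\<in>neighbors N A i. f i j)
      = (\<Sum>i<N. \<Sum>j\<in>neighbors N A i. f i j) + (\<Sum>i<N. \<Sum>j\<in>neighbors N A i. f j i)"
    using sum_neighbors_swap[OF assms, of f] by simp
  also have "\<dots> = graph_energy N A e"
    unfolding graph_energy_def sum.distrib[symmetric]
    by (intro sum.cong refl) (simp add: f_def power2_norm_eq_inner algebra_simps inner_commute)
  finally have g: "(\<Sum>i<N. \<Sum>j\<in>neighbors N A i. f i j) = graph_energy N A e / 2" by simp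
  have "(\<Sum>i<N. e i \<bullet> drift N A H m \<alpha> \<beta> e i)
    = \<alpha> * obs_energy N H m e + \<beta> * (\<Sum>i<N. \<Sum>j\<in>neighbors N A i. f i j)"
    unfolding drift_def obs_energy_def f_def
    by (simp add: inner_right_distrib inner_sum_right sum.distrib sum_distrib_left inner_commute power2_eq_square)
  then show ?thesis by (simp add: g)
qed

lemma norm_sum_power2_le:
  "finite I \<Longrightarrow> (norm (\<Sum>i\<in>I. f i))\<^sup>2 \<le> real (card I) * (\<Sum>i\<in>I. (norm (f i))\<^sup>2)"
proof -
  assume "finite I"
  have "(norm (\<Sum>i\<in>I. f i))\<^sup>2 \<le> (\<Sum>i\<in>I. norm (f i))\<^sup>2"
    by (intro power_mono norm_sum) simp
  also have "\<dots> \<le> (\<Sum>i\<in>I. 1\<^sup>2) * (\<Sum>i\<in>I. (norm (f i))\<^sup>2)"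
    using Cauchy_Schwarz_ineq_sum[of "\<lambda>_. 1" "\<lambda>i. norm (f i)" I] by simp
  finally show ?thesis by simp
qed

lemma norm_add_power2_le: "(norm (x + y :: 'a::real_normed_vector))\<^sup>2 \<le> 2 * (norm x)\<^sup>2 + 2 * (norm y)\<^sup>2"
proof -
  have "(norm (x + y))\<^sup>2 \<le> (norm x + norm y)\<^sup>2"
    by (intro power_mono norm_triangle_ineq) simp
  also have "\<dots> \<le> 2 * (norm x)\<^sup>2 + 2 * (norm y)\<^sup>2"
    using sum_squares_bound[of "norm x" "norm y"] by (simp add: power2_sum)
  finally show ?thesis .
qed

text \<open>Boundedness of \<open>w \<mapsto> H\<^sub>i\<^sup>T w\<^sub>i\<close>, with a constant
  fixed before \<open>w\<close>. It is applied to the noise, to the observed errors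
  \<open>H\<^sub>i e\<^sub>i\<close> and to the observations \<open>H\<^sub>i x\<close> of a common
  vector.\<close>

lemma norm_weighted_rows_bound:
  obtains C where "C \<ge> 0"
    and "\<And>w. (\<Sum>i<N. (norm (\<Sum>k<m i. w i k *\<^sub>R obs_row H i k))\<^sup>2) \<le> C * (\<Sum>i<N. \<Sum>k<m i. (w i k)\<^sup>2)"
proof
  define C where "C = (\<Sum>i<N. \<Sum>k<m i. real (m i) * (norm (obs_row H i k))\<^sup>2)"
  show "C \<ge> 0" by (simp add: C_def sum_nonneg)
  fix w :: "nat \<Rightarrow> nat \<Rightarrow> real"
  have "(norm (\<Sum>k<m i. w i k *\<^sub>R obs_row H i k))\<^sup>2 \<le> C * (\<Sum>k<m i. (w i k)\<^sup>2)" if i: "i < N" for i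
  proof -
    have "(norm (\<Sum>k<m i. w i k *\<^sub>R obs_row H i k))\<^sup>2
      \<le> real (m i) * (\<Sum>k<m i. (norm (w i k *\<^sub>R obs_row H i k))\<^sup>2)"
      using norm_sum_power2_le[of "{..<m i}" "\<lambda>k. w i k *\<^sub>R obs_row H i k"] by simp
    also have "\<dots> = (\<Sum>k<m i. (real (m i) * (norm (obs_row H i k))\<^sup>2) * (w i k)\<^sup>2)"
      by (simp add: sum_distrib_left power_mult_distrib mult_ac)
    also have "\<dots> \<le> (\<Sum>k<m i. C * (w i k)\<^sup>2)"
    proof (intro sum_mono mult_right_mono)
      fix k assume k: "k \<in> {..<m i}"
      have "real (m i) * (norm (obs_row H i k))\<^sup>2 \<le> (\<Sum>k<m i. real (m i) * (norm (obs_row H i k))\<^sup>2)"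
        by (rule member_le_sum[OF k, of "\<lambda>k. real (m i) * (norm (obs_row H i k))\<^sup>2"]) auto
      also have "\<dots> \<le> C" unfolding C_def
        using i by (intro member_le_sum[of i "{..<N}" "\<lambda>i. \<Sum>k<m i. real (m i) * (norm (obs_row H i k))\<^sup>2"])
          (auto intro: sum_nonneg)
      finally show "real (m i) * (norm (obs_row H i k))\<^sup>2 \<le> C" .
    qed simp
    finally show ?thesis by (simp add: sum_distrib_left)
  qed
  then show "(\<Sum>i<N. (norm (\<Sum>k<m i. w i k *\<^sub>R obs_row H i k))\<^sup>2) \<le> C * (\<Sum>i<N. \<Sum>k<m i. (w i k)\<^sup>2)"
    unfolding sum_distrib_left[of C] by (intro sum_mono) (auto simp: sum_distrib_left)
qed

text \<open>The bound is quadratic in the step sizes, whereas the dissipation in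
  \<open>inner_drift\<close> is linear; small steps therefore let the dissipation absorb it.\<close>

lemma norm_drift_bound:
  obtains C where "C \<ge> 0"
    and "\<And>\<alpha> \<beta> e. (\<Sum>i<N. (norm (drift N A H m \<alpha> \<beta> e i))\<^sup>2)
           \<le> C * (\<alpha>\<^sup>2 * obs_energy N H m e + \<beta>\<^sup>2 * graph_energy N A e)"
proof -
  obtain C where C: "C \<ge> 0"
    "\<And>w. (\<Sum>i<N. (norm (\<Sum>k<m i. w i k *\<^sub>R obs_row H i k))\<^sup>2) \<le> C * (\<Sum>i<N. \<Sum>k<m i. (w i k)\<^sup>2)"
    by (rule norm_weighted_rows_bound[where N = N and m = m and H = H]) blast
  show ?thesis
  proof
    show "2 * (C + real N) \<ge> 0" using C by simp
    fix \<alpha> \<beta> :: real and e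
    define F where "F i = (\<Sum>k<m i. (obs_row H i k \<bullet> e i) *\<^sub>R obs_row H i k)" for i
    define L where "L i = (\<Sum>j\<in>neighbors N A i. e i - e j)" for i
    have F: "(\<Sum>i<N. (norm (F i))\<^sup>2) \<le> C * obs_energy N H m e"
      using C(2)[of "\<lambda>i k. obs_row H i k \<bullet> e i"] by (simp add: F_def obs_energy_def)
    have "(norm (L i))\<^sup>2 \<le> real N * (\<Sum>j\<in>neighbors N A i. (norm (e i - e j))\<^sup>2)" for i
    proof -
      have "card (neighbors N A i) \<le> N"
        using card_mono[of "{..<N}" "neighbors N A i"] by (auto simp: neighbors_def)
      then have "real (card (neighbors N A i)) * (\<Sum>j\<in>neighbors N A i. (norm (e i - e j))\<^sup>2)
         \<le> real N * (\<Sum>j\<in>neighbors N A i. (norm (e i - e j))\<^sup>2)"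
        by (intro mult_right_mono sum_nonneg) auto
      with norm_sum_power2_le[of "neighbors N A i" "\<lambda>j. e i - e j"] show ?thesis
        by (simp add: L_def)
    qed
    then have L: "(\<Sum>i<N. (norm (L i))\<^sup>2) \<le> real N * graph_energy N A e"
      unfolding graph_energy_def sum_distrib_left[of "real N"] by (intro sum_mono) (auto simp: sum_distrib_left)
    have "(\<Sum>i<N. (norm (drift N A H m \<alpha> \<beta> e i))\<^sup>2)
       \<le> (\<Sum>i<N. 2 * (norm (\<alpha> *\<^sub>R F i))\<^sup>2 + 2 * (norm (\<beta> *\<^sub>R L i))\<^sup>2)"
      unfolding drift_def F_def L_def by (intro sum_mono norm_add_power2_le)
    also have "\<dots> = 2 * \<alpha>\<^sup>2 * (\<Sum>i<N. (norm (F i))\<^sup>2) + 2 * \<beta>\<^sup>2 * (\<Sum>i<N. (norm (L i))\<^sup>2)"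
      by (simp add: sum.distrib sum_distrib_left power_mult_distrib mult_ac)
    also have "\<dots> \<le> 2 * \<alpha>\<^sup>2 * (C * obs_energy N H m e) + 2 * \<beta>\<^sup>2 * (real N * graph_energy N A e)"
      by (intro add_mono mult_left_mono F L) auto
    also have "\<dots> \<le> 2 * \<alpha>\<^sup>2 * ((C + real N) * obs_energy N H m e) + 2 * \<beta>\<^sup>2 * ((C + real N) * graph_energy N A e)"
      using C(1) by (intro add_mono mult_left_mono mult_right_mono obs_energy_nonneg graph_energy_nonneg) auto
    finally show "(\<Sum>i<N. (norm (drift N A H m \<alpha> \<beta> e i))\<^sup>2)
           \<le> 2 * (C + real N) * (\<alpha>\<^sup>2 * obs_energy N H m e + \<beta>\<^sup>2 * graph_energy N A e)"
      by (simp add: algebra_simps)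
  qed
qed

section \<open>Coercivity and contraction\<close>

text \<open>Since \<open>x = G' *v (G *v x)\<close>, it suffices to bound \<open>G *v x\<close>,
  which is the sum of the vectors \<open>H\<^sub>i\<^sup>T (H\<^sub>i x)\<close> and hence
  controlled by the observations of \<open>x\<close>.\<close>

lemma Gram_coercive:
  fixes H :: "nat \<Rightarrow> nat \<Rightarrow> 'n::finite \<Rightarrow> real"
  assumes "invertible (Gram N H m)"
  obtains C where "C \<ge> 0" and "\<And>x :: real^'n. (norm x)\<^sup>2 \<le> C * (\<Sum>i<N. \<Sum>k<m i. (obs_row H i k \<bullet> x)\<^sup>2)"
proof -
  define G where "G = Gram N H m"
  obtain G' where G': "G' ** G = mat 1" using assms by (auto simp: invertible_def G_def)
  obtain K where K: "\<And>y :: real^'n. norm (G' *v y) \<le> norm y * K" "K \<ge> 0"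
    using bounded_linear.nonneg_bounded[OF matrix_vector_mul_bounded_linear[of G']] by blast
  obtain C where C: "C \<ge> 0"
    "\<And>w. (\<Sum>i<N. (norm (\<Sum>k<m i. w i k *\<^sub>R obs_row H i k))\<^sup>2) \<le> C * (\<Sum>i<N. \<Sum>k<m i. (w i k)\<^sup>2)"
    by (rule norm_weighted_rows_bound[where N = N and m = m and H = H]) blast
  show ?thesis
  proof
    show "K\<^sup>2 * (real N * C) \<ge> 0" using C by simp
    fix x :: "real^'n"
    have "x = G' *v (G *v x)" by (simp add: matrix_vector_mul_assoc G')
    then have "norm x \<le> norm (G *v x) * K" using K(1)[of "G *v x"] by simp
    then have "(norm x)\<^sup>2 \<le> (norm (G *v x) * K)\<^sup>2" by (intro power_mono) auto
    also have "\<dots> = K\<^sup>2 * (norm (G *v x))\<^sup>2" by (simp add: power_mult_distrib)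
    also have "(norm (G *v x))\<^sup>2 \<le> real N * (\<Sum>i<N. (norm (\<Sum>k<m i. (obs_row H i k \<bullet> x) *\<^sub>R obs_row H i k))\<^sup>2)"
      unfolding G_def Gram_mult_eq_sum
      using norm_sum_power2_le[of "{..<N}" "\<lambda>i. \<Sum>k<m i. (obs_row H i k \<bullet> x) *\<^sub>R obs_row H i k"] by simp
    also have "(\<Sum>i<N. (norm (\<Sum>k<m i. (obs_row H i k \<bullet> x) *\<^sub>R obs_row H i k))\<^sup>2)
        \<le> C * (\<Sum>i<N. \<Sum>k<m i. (obs_row H i k \<bullet> x)\<^sup>2)"
      by (rule C(2))
    finally show "(norm x)\<^sup>2 \<le> K\<^sup>2 * (real N * C) * (\<Sum>i<N. \<Sum>k<m i. (obs_row H i k \<bullet> x)\<^sup>2)"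
      by (simp add: mult_left_mono mult.assoc)
  qed
qed

lemma edge_le_graph_energy:
  assumes "undirected_graph N A" "A i j"
  shows "(norm (e i - e j))\<^sup>2 \<le> graph_energy N A e"
proof -
  have ij: "i < N" "j \<in> neighbors N A i" using assms by (auto simp: undirected_graph_def neighbors_def)
  have "(norm (e i - e j))\<^sup>2 \<le> (\<Sum>j\<in>neighbors N A i. (norm (e i - e j))\<^sup>2)"
    by (rule member_le_sum[OF ij(2), of "\<lambda>j. (norm (e i - e j))\<^sup>2"]) auto
  also have "\<dots> \<le> graph_energy N A e" unfolding graph_energy_def
    using ij(1) by (intro member_le_sum[of i "{..<N}" "\<lambda>i. \<Sum>j\<in>neighbors N A i. (norm (e i - e j))\<^sup>2"])
      (auto intro: sum_nonneg)
  finally show ?thesis .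
qed

text \<open>Each edge of the walk costs at most the graph energy, and the squared triangle
  inequality turns \<open>C\<close> into \<open>2 * C + 2\<close>. The constant depends on the walk
  but not on \<open>e\<close>, hence the order of the quantifiers.\<close>

lemma walk_le_graph_energy:
  assumes g: "undirected_graph N A" and "A\<^sup>*\<^sup>* i j"
  shows "\<exists>C\<ge>0. \<forall>e :: nat \<Rightarrow> real^'n::finite. (norm (e i - e j))\<^sup>2 \<le> C * graph_energy N A e"
  using assms(2)
proof (induction rule: rtranclp_induct)
  case base show ?case by (auto intro!: exI[of _ 0])
next
  case (step j k)
  then obtain C where C: "C \<ge> 0" "\<And>e :: nat \<Rightarrow> real^'n. (norm (e i - e j))\<^sup>2 \<le> C * graph_energy N A e"
    by blast
  have "(norm (e i - e k))\<^sup>2 \<le> (2 * C + 2) * graph_energy N A e" for e :: "nat \<Rightarrow> real^'n"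
    using norm_add_power2_le[of "e i - e j" "e j - e k"] C(2)[of e] edge_le_graph_energy[OF g step(2), of e]
    by (simp add: algebra_simps)
  then show ?case using C(1) by (intro exI[of _ "2 * C + 2"]) auto
qed

text \<open>The graph energy controls every \<open>e i - e 0\<close>. Replacing \<open>e i\<close>
  by \<open>e 0\<close> in the observation energy then costs only graph energy, and for the common
  vector \<open>e 0\<close> the Gram matrix is coercive.\<close>

lemma energy_coercive:
  fixes H :: "nat \<Rightarrow> nat \<Rightarrow> 'n::finite \<Rightarrow> real"
  assumes g: "undirected_graph N A" and conn: "graph_connected N A"
    and inv: "invertible (Gram N H m)" and N: "N > 0"
  obtains C where "C > 0"
    and "\<And>e. (\<Sum>i<N. (norm (e i))\<^sup>2) \<le> C * (obs_energy N H m e + graph_energy N A e)"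
proof -
  obtain K where K: "K \<ge> 0" "\<And>x :: real^'n. (norm x)\<^sup>2 \<le> K * (\<Sum>i<N. \<Sum>k<m i. (obs_row H i k \<bullet> x)\<^sup>2)"
    by (rule Gram_coercive[OF inv]) blast
  \<comment> \<open>Agent 0 is the reference vertex, which exists because
    \<open>N > 0\<close>.\<close>
  have "\<forall>i. \<exists>C. i < N \<longrightarrow> C \<ge> 0 \<and> (\<forall>e :: nat \<Rightarrow> real^'n. (norm (e i - e 0))\<^sup>2 \<le> C * graph_energy N A e)"
    using walk_le_graph_energy[OF g] conn N unfolding graph_connected_def by metis
  then obtain c where c: "\<And>i. i < N \<Longrightarrow> c i \<ge> 0"
    "\<And>i e. i < N \<Longrightarrow> (norm (e i - e 0 :: real^'n))\<^sup>2 \<le> c i * graph_energy N A e"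
    by metis
  define R where "R = (\<Sum>i<N. \<Sum>k<m i. (norm (obs_row H i k))\<^sup>2 * c i)"
  define Q where "Q = (\<Sum>i<N. c i)"
  have R0: "R \<ge> 0" unfolding R_def using c(1) by (auto intro!: sum_nonneg)
  have Q0: "Q \<ge> 0" unfolding Q_def using c(1) by (auto intro!: sum_nonneg)
  have main: "(\<Sum>i<N. (norm (e i))\<^sup>2) \<le> real N * (4 * K) * obs_energy N H m e
      + (real N * (4 * K) * R + 2 * Q) * graph_energy N A e" for e :: "nat \<Rightarrow> real^'n"
  proof -
    let ?g = "graph_energy N A e"
    have "(\<Sum>i<N. \<Sum>k<m i. (obs_row H i k \<bullet> e 0)\<^sup>2)
       \<le> (\<Sum>i<N. \<Sum>k<m i. 2 * (obs_row H i k \<bullet> e i)\<^sup>2 + 2 * ((norm (obs_row H i k))\<^sup>2 * c i * ?g))"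
    proof (intro sum_mono)
      fix i k assume i: "i \<in> {..<N}"
      have "(obs_row H i k \<bullet> e 0)\<^sup>2 = (norm (obs_row H i k \<bullet> e i + obs_row H i k \<bullet> (e 0 - e i)))\<^sup>2"
        by (simp add: algebra_simps)
      also have "\<dots> \<le> 2 * (obs_row H i k \<bullet> e i)\<^sup>2 + 2 * (obs_row H i k \<bullet> (e 0 - e i))\<^sup>2"
        using norm_add_power2_le[of "obs_row H i k \<bullet> e i" "obs_row H i k \<bullet> (e 0 - e i)"] by simp
      also have "(obs_row H i k \<bullet> (e 0 - e i))\<^sup>2 \<le> (norm (obs_row H i k) * norm (e 0 - e i))\<^sup>2"
        using Cauchy_Schwarz_ineq2[of "obs_row H i k" "e 0 - e i"] by (simp add: abs_le_square_iff[symmetric] abs_mult)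
      also have "\<dots> = (norm (obs_row H i k))\<^sup>2 * (norm (e i - e 0))\<^sup>2"
        by (simp add: power_mult_distrib norm_minus_commute)
      also have "\<dots> \<le> (norm (obs_row H i k))\<^sup>2 * (c i * ?g)"
        using c(2)[of i e] i by (intro mult_left_mono) auto
      finally show "(obs_row H i k \<bullet> e 0)\<^sup>2
         \<le> 2 * (obs_row H i k \<bullet> e i)\<^sup>2 + 2 * ((norm (obs_row H i k))\<^sup>2 * c i * ?g)"
        by (simp add: mult.assoc)
    qed
    also have "\<dots> = 2 * obs_energy N H m e + 2 * R * ?g"
      by (simp add: sum.distrib obs_energy_def R_def sum_distrib_left sum_distrib_right mult_ac)
    finally have "K * (\<Sum>i<N. \<Sum>k<m i. (obs_row H i k \<bullet> e 0)\<^sup>2) \<le> K * (2 * obs_energy N H m e + 2 * R * ?g)"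
      using K(1) by (rule mult_left_mono)
    with K(2)[of "e 0"] have e0: "(norm (e 0))\<^sup>2 \<le> K * (2 * obs_energy N H m e + 2 * R * ?g)" by linarith
    have "(norm (e i))\<^sup>2 \<le> 2 * (K * (2 * obs_energy N H m e + 2 * R * ?g)) + 2 * (c i * ?g)" if "i < N" for i
      using norm_add_power2_le[of "e 0" "e i - e 0"] e0 c(2)[OF that, of e] by simp
    then have "(\<Sum>i<N. (norm (e i))\<^sup>2) \<le> (\<Sum>i<N. 2 * (K * (2 * obs_energy N H m e + 2 * R * ?g)) + 2 * (c i * ?g))"
      by (intro sum_mono) auto
    also have "\<dots> = real N * (4 * K) * obs_energy N H m e + (real N * (4 * K) * R + 2 * Q) * ?g"
      by (simp add: sum.distrib Q_def sum_distrib_left sum_distrib_right algebra_simps)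
    finally show ?thesis .
  qed
  \<comment> \<open>The sum dominates both coefficients in \<open>main\<close>; the final 1 makes it
    strictly positive, so that the contraction rate can be defined by dividing by it.\<close>
  define C where "C = real N * (4 * K) + (real N * (4 * K) * R + 2 * Q) + 1"
  have C: "C > 0" using K(1) R0 Q0 by (simp add: C_def add_nonneg_pos)
  have "(\<Sum>i<N. (norm (e i))\<^sup>2) \<le> C * (obs_energy N H m e + graph_energy N A e)" for e :: "nat \<Rightarrow> real^'n"
  proof -
    have "real N * (4 * K) * obs_energy N H m e \<le> C * obs_energy N H m e"
      using K(1) R0 Q0 by (intro mult_right_mono obs_energy_nonneg) (auto simp: C_def)
    moreover have "(real N * (4 * K) * R + 2 * Q) * graph_energy N A e \<le> C * graph_energy N A e"
      using K(1) by (intro mult_right_mono graph_energy_nonneg) (auto simp: C_def)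
    ultimately show ?thesis using main[of e] by (simp add: algebra_simps)
  qed
  with C that show ?thesis by blast
qed

text \<open>Expanding the square, the cross term removes twice \<alpha> times the observation energy
  plus \<beta> times the graph energy. For small steps the quadratic term gives back at most half of
  this, and coercivity bounds the other half from below by a multiple of \<alpha> times the squared
  norm.\<close>

lemma drift_contraction:
  fixes H :: "nat \<Rightarrow> nat \<Rightarrow> 'n::finite \<Rightarrow> real"
  assumes g: "undirected_graph N A" and conn: "graph_connected N A"
    and inv: "invertible (Gram N H m)" and N: "N > 0" and r: "r > 0"
  obtains c \<kappa> where "c > 0" "\<kappa> > 0" "c * \<kappa> \<le> 1"
    and "\<And>\<alpha> \<beta> e. \<lbrakk>0 \<le> \<alpha>; r * \<alpha> \<le> \<beta>; \<alpha> \<le> \<kappa>; \<beta> \<le> \<kappa>\<rbrakk> \<Longrightarrow>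
       (\<Sum>i<N. (norm (e i - drift N A H m \<alpha> \<beta> e i))\<^sup>2) \<le> (1 - c * \<alpha>) * (\<Sum>i<N. (norm (e i))\<^sup>2)"
proof -
  obtain C where C: "C > 0"
    "\<And>e :: nat \<Rightarrow> real^'n. (\<Sum>i<N. (norm (e i))\<^sup>2) \<le> C * (obs_energy N H m e + graph_energy N A e)"
    by (rule energy_coercive[OF g conn inv N]) blast
  obtain D where D: "D \<ge> 0" "\<And>\<alpha> \<beta> e. (\<Sum>i<N. (norm (drift N A H m \<alpha> \<beta> e i))\<^sup>2)
           \<le> D * (\<alpha>\<^sup>2 * obs_energy N H m e + \<beta>\<^sup>2 * graph_energy N A e)"
    by (rule norm_drift_bound[of N A H m]) blast
  \<comment> \<open>\<open>min 1 (r / 2)\<close> comes from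
    \<open>\<beta> / 2 \<ge> r * \<alpha> / 2\<close>, and \<open>C\<close> from coercivity. In
    \<kappa>, the first bound gives \<open>D * \<kappa> \<le> 1 / 2\<close>, with
    \<open>2 * D + 1\<close> covering \<open>D = 0\<close>, and the second gives
    \<open>c * \<kappa> \<le> 1\<close>.\<close>
  define c where "c = min 1 (r / 2) / C"
  define \<kappa> where "\<kappa> = min (1 / (2 * D + 1)) (1 / c)"
  have c: "c > 0" using C(1) r by (simp add: c_def)
  have \<kappa>: "\<kappa> > 0" using c D(1) by (simp add: \<kappa>_def)
  have c\<kappa>: "c * \<kappa> \<le> 1"
  proof -
    have "c * \<kappa> \<le> c * (1 / c)" using c by (intro mult_left_mono) (auto simp: \<kappa>_def)
    then show ?thesis using c by simp
  qed
  have D\<kappa>: "D * \<kappa> \<le> 1 / 2"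
  proof -
    have "D * \<kappa> \<le> D * (1 / (2 * D + 1))" using D(1) by (intro mult_left_mono) (auto simp: \<kappa>_def)
    also have "\<dots> \<le> 1 / 2" using D(1) by (simp add: field_simps)
    finally show ?thesis .
  qed
  have "(\<Sum>i<N. (norm (e i - drift N A H m \<alpha> \<beta> e i))\<^sup>2) \<le> (1 - c * \<alpha>) * (\<Sum>i<N. (norm (e i))\<^sup>2)"
    if \<alpha>: "0 \<le> \<alpha>" "r * \<alpha> \<le> \<beta>" "\<alpha> \<le> \<kappa>" "\<beta> \<le> \<kappa>" for \<alpha> \<beta> and e :: "nat \<Rightarrow> real^'n"
  proof -
    let ?o = "obs_energy N H m e" and ?g = "graph_energy N A e"
    have \<beta>: "0 \<le> \<beta>" using \<alpha> r by (meson mult_nonneg_nonneg less_imp_le order_trans)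
    have o: "?o \<ge> 0" and gg: "?g \<ge> 0" by (rule obs_energy_nonneg, rule graph_energy_nonneg)
    have "(\<Sum>i<N. (norm (e i - drift N A H m \<alpha> \<beta> e i))\<^sup>2)
       = (\<Sum>i<N. (norm (e i))\<^sup>2) - 2 * (\<Sum>i<N. e i \<bullet> drift N A H m \<alpha> \<beta> e i)
         + (\<Sum>i<N. (norm (drift N A H m \<alpha> \<beta> e i))\<^sup>2)"
      by (simp add: power2_norm_eq_inner inner_diff_left inner_diff_right inner_commute
          sum.distrib sum_subtractf sum_distrib_left algebra_simps)
    moreover have "(\<Sum>i<N. (norm (drift N A H m \<alpha> \<beta> e i))\<^sup>2) \<le> \<alpha> * ?o + \<beta> / 2 * ?g"
    proof -
      have "D * \<alpha>\<^sup>2 \<le> \<alpha> / 2" "D * \<beta>\<^sup>2 \<le> \<beta> / 2"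
      proof -
        have "D * \<alpha> \<le> 1/2" "D * \<beta> \<le> 1/2"
          using D\<kappa> mult_left_mono[OF \<alpha>(3) D(1)] mult_left_mono[OF \<alpha>(4) D(1)] by linarith+
        from mult_right_mono[OF this(1) \<alpha>(1)] mult_right_mono[OF this(2) \<beta>]
        show "D * \<alpha>\<^sup>2 \<le> \<alpha> / 2" "D * \<beta>\<^sup>2 \<le> \<beta> / 2" by (simp_all add: power2_eq_square mult.assoc)
      qed
      moreover have "\<alpha> / 2 \<le> \<alpha>" using \<alpha>(1) by simp
      ultimately have "D * \<alpha>\<^sup>2 * ?o \<le> \<alpha> * ?o" "D * \<beta>\<^sup>2 * ?g \<le> \<beta> / 2 * ?g"
        using o gg by (intro mult_right_mono; linarith)+
      then show ?thesis using D(2)[of \<alpha> \<beta> e] by (simp add: algebra_simps)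
    qed
    moreover have "c * \<alpha> * (\<Sum>i<N. (norm (e i))\<^sup>2) \<le> \<alpha> * ?o + \<beta> / 2 * ?g"
    proof -
      have "c * \<alpha> * (\<Sum>i<N. (norm (e i))\<^sup>2) \<le> c * \<alpha> * (C * (?o + ?g))"
        using c \<alpha>(1) by (intro mult_left_mono C(2)) auto
      also have "\<dots> = (min 1 (r/2) * \<alpha>) * ?o + (min 1 (r/2) * \<alpha>) * ?g"
        using C(1) by (simp add: c_def field_simps)
      also have "\<dots> \<le> \<alpha> * ?o + \<beta> / 2 * ?g"
      proof (intro add_mono mult_right_mono o gg)
        show "min 1 (r/2) * \<alpha> \<le> \<alpha>" using mult_right_mono[of "min 1 (r/2)" 1 \<alpha>] \<alpha>(1) by simp
        show "min 1 (r/2) * \<alpha> \<le> \<beta> / 2" using mult_right_mono[OF min.cobounded2[of 1 "r/2"] \<alpha>(1)] \<alpha>(2) by linarith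
      qed
      finally show ?thesis .
    qed
    ultimately show ?thesis by (simp add: inner_drift[OF g] algebra_simps)
  qed
  with c \<kappa> c\<kappa> that show ?thesis by blast
qed

section \<open>The error component driven by the noise\<close>

text \<open>The natural filtration of \<open>W\<close>, with time \<open>t\<close> itself excluded.
  As a preimage algebra of one product-valued map it has the form in which independence of disjoint
  blocks of \<open>W\<close> is stated.\<close>

definition past :: "'a measure \<Rightarrow> 'b measure \<Rightarrow> (nat \<Rightarrow> 'a \<Rightarrow> 'b) \<Rightarrow> nat \<Rightarrow> 'a measure" where
  "past M S W t = vimage_algebra (space M) (\<lambda>\<omega>. \<lambda>i\<in>{..<t}. W i \<omega>) (PiM {..<t} (\<lambda>_. S))"

lemma space_past [simp]: "space (past M S W t) = space M"
  by (simp add: past_def)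

lemma measurable_past_component:
  assumes W: "\<And>i. W i \<in> measurable M S" and i: "i < t"
  shows "W i \<in> measurable (past M S W t) S"
proof -
  have "(\<lambda>\<omega>. \<lambda>i\<in>{..<t}. W i \<omega>) \<in> measurable (past M S W t) (PiM {..<t} (\<lambda>_. S))"
    unfolding past_def
    by (rule measurable_vimage_algebra1) (simp add: space_PiM measurable_space[OF W])
  then have "(\<lambda>\<omega>. (\<lambda>i\<in>{..<t}. W i \<omega>) i) \<in> measurable (past M S W t) S"
    by (rule measurable_compose) (use i in \<open>auto intro: measurable_component_singleton\<close>)
  then show ?thesis using i by simp
qed

lemma past_mono:
  assumes W: "\<And>i. W i \<in> measurable M S" and st: "s \<le> t"
    and f: "f \<in> measurable (past M S W s) L"
  shows "f \<in> measurable (past M S W t) L"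
proof -
  have "(\<lambda>\<omega>. \<omega>) \<in> measurable (past M S W t) (past M S W s)"
    unfolding past_def[of _ _ _ s]
    by (rule measurable_vimage_algebra2)
      (use st in \<open>auto intro!: measurable_restrict measurable_past_component[OF W]\<close>)
  from measurable_compose[OF this f] show ?thesis by simp
qed

lemma past_subalgebra:
  assumes W: "\<And>i. W i \<in> measurable M S" and f: "f \<in> measurable (past M S W t) L"
  shows "f \<in> measurable M L"
proof -
  have "(\<lambda>\<omega>. \<omega>) \<in> measurable M (past M S W t)"
    unfolding past_def
    by (rule measurable_vimage_algebra2) (auto intro!: measurable_restrict W)
  from measurable_compose[OF this f] show ?thesis by simp
qed

text \<open>The blocks \<open>{..<t}\<close> and \<open>{t}\<close> are disjoint, so the
  sigma-algebras they generate are independent; those generated by \<open>f\<close> and by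
  \<open>g (W t \<omega>)\<close> are contained in them.\<close>

lemma (in prob_space) past_indep_present:
  assumes indep: "indep_vars (\<lambda>_. S) W UNIV"
    and f: "f \<in> borel_measurable (past M S W t)" and g: "g \<in> borel_measurable S"
  shows "indep_var borel f borel (\<lambda>\<omega>. g (W t \<omega>))"
proof -
  have W: "W i \<in> measurable M S" for i using indep by (auto simp: indep_vars_def)
  let ?X = "\<lambda>\<omega>. \<lambda>i\<in>{..<t}. W i \<omega>" and ?Y = "\<lambda>\<omega>. \<lambda>i\<in>{t}. W i \<omega>"
  define P where "P = vimage_algebra (space M) ?Y (PiM {t} (\<lambda>_. S))"
  have "indep_var (PiM {..<t} (\<lambda>_. S)) ?X (PiM {t} (\<lambda>_. S)) ?Y"
    by (rule indep_var_restrict[OF indep]) auto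
  then have *: "indep_set (sets (past M S W t)) (sets P)"
    by (simp add: indep_var_eq past_def P_def sets_vimage_algebra)
  have "?Y \<in> measurable P (PiM {t} (\<lambda>_. S))"
    unfolding P_def by (rule measurable_vimage_algebra1) (simp add: space_PiM measurable_space[OF W])
  moreover have "(\<lambda>h. h t) \<in> measurable (PiM {t} (\<lambda>_. S)) S"
    by (rule measurable_component_singleton) simp
  ultimately have "(\<lambda>\<omega>. g (?Y \<omega> t)) \<in> borel_measurable P"
    by (rule measurable_compose[OF measurable_compose g])
  then have gP: "(\<lambda>\<omega>. g (W t \<omega>)) \<in> borel_measurable P" by simp
  have "sigma_sets (space M) {f -` A \<inter> space M | A. A \<in> sets borel} \<subseteq> sets (past M S W t)"
    using sets.sigma_sets_subset[of "{f -` A \<inter> space M | A. A \<in> sets borel}" "past M S W t"]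
      measurable_sets[OF f] by auto
  moreover have "sigma_sets (space M) {(\<lambda>\<omega>. g (W t \<omega>)) -` A \<inter> space M | A. A \<in> sets borel} \<subseteq> sets P"
    using sets.sigma_sets_subset[of "{(\<lambda>\<omega>. g (W t \<omega>)) -` A \<inter> space M | A. A \<in> sets borel}" P]
      measurable_sets[OF gP] by (auto simp: P_def)
  ultimately have "indep_set (sigma_sets (space M) {f -` A \<inter> space M | A. A \<in> sets borel})
      (sigma_sets (space M) {(\<lambda>\<omega>. g (W t \<omega>)) -` A \<inter> space M | A. A \<in> sets borel})"
    using * unfolding indep_sets2_eq by blast
  moreover have "f \<in> borel_measurable M" by (rule past_subalgebra[OF W f])
  moreover have "(\<lambda>\<omega>. g (W t \<omega>)) \<in> borel_measurable M" by (rule measurable_compose[OF W g])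
  ultimately show ?thesis unfolding indep_var_eq by simp
qed

text \<open>The martingale difference property in product form; it takes the place of conditional
  expectations.\<close>

lemma (in prob_space) past_times_centred:
  fixes f :: "'a \<Rightarrow> real"
  assumes indep: "indep_vars (\<lambda>_. S) W UNIV"
    and f: "f \<in> borel_measurable (past M S W t)" "integrable M f"
    and g: "g \<in> borel_measurable S" "integrable M (\<lambda>\<omega>. g (W t \<omega>))" "expectation (\<lambda>\<omega>. g (W t \<omega>)) = 0"
  shows "integrable M (\<lambda>\<omega>. f \<omega> * g (W t \<omega>))" "expectation (\<lambda>\<omega>. f \<omega> * g (W t \<omega>)) = 0"
  using indep_var_integrable[OF past_indep_present[OF indep f(1) g(1)] f(2) g(2)]
    indep_var_lebesgue_integral[OF past_indep_present[OF indep f(1) g(1)] f(2) g(2)] g(3)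
  by auto

section \<open>Almost sure convergence of the noise-driven recursion\<close>

text \<open>The component \<open>p\<close> along one noise path. It starts at 0, so the initial
  error is left to \<open>q\<close>.\<close>

primrec noise_error :: "nat \<Rightarrow> (nat \<Rightarrow> nat \<Rightarrow> bool) \<Rightarrow> (nat \<Rightarrow> nat \<Rightarrow> 'n::finite \<Rightarrow> real) \<Rightarrow> (nat \<Rightarrow> nat)
   \<Rightarrow> (nat \<Rightarrow> real) \<Rightarrow> (nat \<Rightarrow> real) \<Rightarrow> (nat \<Rightarrow> nat \<Rightarrow> nat \<Rightarrow> real) \<Rightarrow> nat \<Rightarrow> nat \<Rightarrow> real^'n" where
  "noise_error N A H m \<alpha> \<beta> v 0 = (\<lambda>i. 0)"
| "noise_error N A H m \<alpha> \<beta> v (Suc t) =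
    (\<lambda>i. noise_error N A H m \<alpha> \<beta> v t i - drift N A H m (\<alpha> t) (\<beta> t) (noise_error N A H m \<alpha> \<beta> v t) i
       + \<alpha> t *\<^sub>R (\<Sum>k<m i. v t i k *\<^sub>R obs_row H i k))"

text \<open>One inequality, integrated over an arbitrary event \<open>B\<close> of the past, is used
  twice: with \<open>B\<close> the whole space it sends the means to 0, and with \<open>B\<close>
  the event of having stayed below a level it is the near-supermartingale property.\<close>

lemma (in prob_space) noise_error_AE_tendsto_zero:
  fixes v :: "nat \<Rightarrow> nat \<Rightarrow> nat \<Rightarrow> 'a \<Rightarrow> real" and H :: "nat \<Rightarrow> nat \<Rightarrow> 'n::finite \<Rightarrow> real"
  assumes zero_mean: "\<And>t i k. i < N \<Longrightarrow> k < m i \<Longrightarrow>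
        integrable M (v t i k) \<and> integral\<^sup>L M (v t i k) = 0"
    and indep: "indep_vars (\<lambda>_. PiM (noise_idx N m) (\<lambda>_. borel)) (\<lambda>t. stacked N m (v t)) UNIV"
    and square: "\<And>t. integrable M (\<lambda>\<omega>. \<Sum>i<N. \<Sum>k<m i. (v t i k \<omega>)\<^sup>2)"
      "\<And>t. expectation (\<lambda>\<omega>. \<Sum>i<N. \<Sum>k<m i. (v t i k \<omega>)\<^sup>2) \<le> \<sigma>"
    and contr: "\<And>t e. (\<Sum>i<N. (norm (e i - drift N A H m (\<alpha> t) (\<beta> t) e i))\<^sup>2)
        \<le> (1 - c * \<alpha> t) * (\<Sum>i<N. (norm (e i))\<^sup>2)"
    and c: "c > 0" and \<alpha>: "\<And>t. 0 \<le> \<alpha> t" "\<And>t. c * \<alpha> t \<le> 1"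
    and sum: "\<not> summable \<alpha>" "summable (\<lambda>t. (\<alpha> t)\<^sup>2)"
  shows "AE \<omega> in M. (\<lambda>t. \<Sum>i<N. (norm (noise_error N A H m \<alpha> \<beta> (\<lambda>t i k. v t i k \<omega>) t i))\<^sup>2) \<longlonglongrightarrow> 0"
proof -
  define S :: "(nat \<times> nat \<Rightarrow> real) measure" where "S = PiM (noise_idx N m) (\<lambda>_. borel)"
  define W where "W t = stacked N m (v t)" for t
  define F where "F = past M S W"
  define p where "p t \<omega> = noise_error N A H m \<alpha> \<beta> (\<lambda>t i k. v t i k \<omega>) t" for t \<omega>
  define V where "V t \<omega> = (\<Sum>i<N. (norm (p t \<omega> i))\<^sup>2)" for t \<omega>
  define y where "y t \<omega> i = p t \<omega> i - drift N A H m (\<alpha> t) (\<beta> t) (p t \<omega>) i" for t \<omega> i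
  define Z where "Z t \<omega> = (\<Sum>i<N. \<Sum>k<m i. (obs_row H i k \<bullet> y t \<omega> i) * v t i k \<omega>)" for t \<omega>
  define R where "R t \<omega> = (\<Sum>i<N. \<Sum>k<m i. (v t i k \<omega>)\<^sup>2)" for t \<omega>
  have ind: "indep_vars (\<lambda>_. S) W UNIV" using indep by (simp add: S_def W_def[abs_def])
  have W: "W t \<in> measurable M S" for t using ind by (auto simp: indep_vars_def)
  have vW: "v t i k \<omega> = W t \<omega> (i, k)" if "i < N" "k < m i" for t i k \<omega>
    using that by (simp add: W_def stacked_def noise_idx_def)
  have proj: "(\<lambda>h. h (i, k)) \<in> borel_measurable S" if "i < N" "k < m i" for i k
    unfolding S_def using that by (intro measurable_component_singleton) (simp add: noise_idx_def)
  \<comment> \<open>The noise of time \<open>t\<close> enters the filtration only at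
    \<open>Suc t\<close>, whereas \<open>p t\<close> depends on earlier noise alone; so
    \<open>p t\<close> and the noise at \<open>t\<close> are independent.\<close>
  have v_past: "v t i k \<in> borel_measurable (F (Suc t))" if "i < N" "k < m i" for t i k
  proof -
    have "(\<lambda>\<omega>. W t \<omega> (i, k)) \<in> borel_measurable (F (Suc t))"
      unfolding F_def by (rule measurable_compose[OF measurable_past_component[OF W] proj[OF that]]) simp
    then show ?thesis by (simp add: vW[OF that, symmetric])
  qed
  have p_past: "(\<lambda>\<omega>. p t \<omega> i) \<in> borel_measurable (F t)" if "i < N" for t i
    using that
  proof (induction t arbitrary: i)
    case 0 then show ?case by (simp add: p_def)
  next
    case (Suc t)
    have IH: "(\<lambda>\<omega>. p t \<omega> j) \<in> borel_measurable (F (Suc t))" if "j < N" for j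
      using past_mono[OF W, of t "Suc t"] Suc.IH[OF that] by (auto simp: F_def)
    have nb: "(\<lambda>\<omega>. \<Sum>j\<in>neighbors N A i. p t \<omega> i - p t \<omega> j) \<in> borel_measurable (F (Suc t))"
      using IH Suc.prems by (intro borel_measurable_sum borel_measurable_diff) (auto dest: neighbors_less)
    have ns: "(\<lambda>\<omega>. \<Sum>k<m i. v t i k \<omega> *\<^sub>R obs_row H i k) \<in> borel_measurable (F (Suc t))"
      using v_past Suc.prems by (intro borel_measurable_sum borel_measurable_scaleR) auto
    have ob: "(\<lambda>\<omega>. \<Sum>k<m i. (obs_row H i k \<bullet> p t \<omega> i) *\<^sub>R obs_row H i k) \<in> borel_measurable (F (Suc t))"
      using IH Suc.prems by (intro borel_measurable_sum borel_measurable_scaleR borel_measurable_inner) auto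
    have eq: "p (Suc t) \<omega> i = p t \<omega> i - (\<alpha> t *\<^sub>R (\<Sum>k<m i. (obs_row H i k \<bullet> p t \<omega> i) *\<^sub>R obs_row H i k)
        + \<beta> t *\<^sub>R (\<Sum>j\<in>neighbors N A i. p t \<omega> i - p t \<omega> j)) + \<alpha> t *\<^sub>R (\<Sum>k<m i. v t i k \<omega> *\<^sub>R obs_row H i k)" for \<omega>
      by (simp add: p_def drift_def)
    show ?case unfolding eq
      by (intro borel_measurable_add borel_measurable_diff borel_measurable_scaleR IH Suc.prems nb ns ob) auto
  qed
  have y_past: "(\<lambda>\<omega>. y t \<omega> i) \<in> borel_measurable (F t)" if "i < N" for t i
  proof -
    have nb: "(\<lambda>\<omega>. \<Sum>j\<in>neighbors N A i. p t \<omega> i - p t \<omega> j) \<in> borel_measurable (F t)"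
      using p_past that by (intro borel_measurable_sum borel_measurable_diff) (auto dest: neighbors_less)
    have ob: "(\<lambda>\<omega>. \<Sum>k<m i. (obs_row H i k \<bullet> p t \<omega> i) *\<^sub>R obs_row H i k) \<in> borel_measurable (F t)"
      using p_past that by (intro borel_measurable_sum borel_measurable_scaleR borel_measurable_inner) auto
    show ?thesis unfolding y_def drift_def
      by (intro borel_measurable_add borel_measurable_diff borel_measurable_scaleR p_past that nb ob) auto
  qed
  have V_past: "V t \<in> borel_measurable (F t)" for t
    unfolding V_def by (intro borel_measurable_sum borel_measurable_power measurable_compose[OF p_past borel_measurable_norm]) auto
  have toM: "f \<in> borel_measurable M" if "f \<in> borel_measurable (F t)" for f :: "'a \<Rightarrow> real" and t
    using past_subalgebra[OF W] that by (auto simp: F_def)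
  have V_nonneg: "0 \<le> V t \<omega>" for t \<omega> by (simp add: V_def sum_nonneg)
  have y_le: "(\<Sum>i<N. (norm (y t \<omega> i))\<^sup>2) \<le> (1 - c * \<alpha> t) * V t \<omega>" for t \<omega>
    unfolding y_def V_def by (rule contr)
  obtain C where C: "C \<ge> 0"
    "\<And>w. (\<Sum>i<N. (norm (\<Sum>k<m i. w i k *\<^sub>R obs_row H i k))\<^sup>2) \<le> C * (\<Sum>i<N. \<Sum>k<m i. (w i k)\<^sup>2)"
    by (rule norm_weighted_rows_bound[where N = N and m = m and H = H]) blast
  have V_Suc: "V (Suc t) \<omega> \<le> (1 - c * \<alpha> t) * V t \<omega> + 2 * \<alpha> t * Z t \<omega> + (\<alpha> t)\<^sup>2 * C * R t \<omega>" for t \<omega>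
  proof -
    define n where "n i = (\<Sum>k<m i. v t i k \<omega> *\<^sub>R obs_row H i k)" for i
    have "V (Suc t) \<omega> = (\<Sum>i<N. (norm (y t \<omega> i + \<alpha> t *\<^sub>R n i))\<^sup>2)"
      by (simp add: V_def p_def y_def n_def)
    also have "\<dots> = (\<Sum>i<N. (norm (y t \<omega> i))\<^sup>2) + 2 * \<alpha> t * (\<Sum>i<N. y t \<omega> i \<bullet> n i) + (\<alpha> t)\<^sup>2 * (\<Sum>i<N. (norm (n i))\<^sup>2)"
      unfolding power2_norm_eq_inner
      by (simp add: inner_add_left inner_add_right inner_commute sum.distrib sum_distrib_left
          algebra_simps power2_eq_square)
    also have "(\<Sum>i<N. y t \<omega> i \<bullet> n i) = Z t \<omega>"
      by (simp add: Z_def n_def inner_sum_right inner_commute mult.commute)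
    finally show ?thesis
      using y_le[of t \<omega>] mult_left_mono[OF C(2)[of "\<lambda>i k. v t i k \<omega>"], of "(\<alpha> t)\<^sup>2"]
      by (simp add: n_def R_def mult.assoc)
  qed
  \<comment> \<open>Integrability of \<open>V t\<close> is a premise here because
    \<open>V_int\<close> is proved by induction, each step of which uses this fact.\<close>
  have Z_centred: "integrable M (\<lambda>\<omega>. indicator B \<omega> * Z t \<omega>)" "expectation (\<lambda>\<omega>. indicator B \<omega> * Z t \<omega>) = 0"
    if V: "integrable M (V t)" and B: "B \<in> sets (F t)" for t B
  proof -
    have t1: "integrable M (\<lambda>\<omega>. (indicator B \<omega> * (obs_row H i k \<bullet> y t \<omega> i)) * v t i k \<omega>)
      \<and> expectation (\<lambda>\<omega>. (indicator B \<omega> * (obs_row H i k \<bullet> y t \<omega> i)) * v t i k \<omega>) = 0"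
      if ik: "i < N" "k < m i" for i k
    proof -
      let ?f = "\<lambda>\<omega>. indicator B \<omega> * (obs_row H i k \<bullet> y t \<omega> i) :: real"
      have f: "?f \<in> borel_measurable (F t)"
        using B y_past[OF ik(1)] by (intro borel_measurable_times borel_measurable_indicator borel_measurable_inner) auto
      have "integrable M ?f"
      proof (rule Bochner_Integration.integrable_bound)
        \<comment> \<open>The factor is linear in \<open>y\<close>, and
          \<open>norm y \<le> 1 + (norm y)\<^sup>2\<close> bounds it by the integrable
          \<open>1 + V t \<omega>\<close>.\<close>
        show "integrable M (\<lambda>\<omega>. norm (obs_row H i k) * (1 + V t \<omega>))" using V by simp
        show "?f \<in> borel_measurable M" by (rule toM[OF f])
        show "AE \<omega> in M. norm (?f \<omega>) \<le> norm (norm (obs_row H i k) * (1 + V t \<omega>))"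
        proof (rule AE_I2)
          fix \<omega>
          have "(norm (y t \<omega> i))\<^sup>2 \<le> (\<Sum>i<N. (norm (y t \<omega> i))\<^sup>2)"
            using ik by (intro member_le_sum[of i "{..<N}" "\<lambda>i. (norm (y t \<omega> i))\<^sup>2"]) auto
          also have "\<dots> \<le> (1 - c * \<alpha> t) * V t \<omega>" by (rule y_le)
          also have "\<dots> \<le> 1 * V t \<omega>" using c \<alpha> V_nonneg by (intro mult_right_mono) auto
          finally have "(norm (y t \<omega> i))\<^sup>2 \<le> V t \<omega>" by simp
          moreover have "norm (y t \<omega> i) \<le> 1 + (norm (y t \<omega> i))\<^sup>2"
            using sum_squares_bound[of "norm (y t \<omega> i)" 1] zero_le_power2[of "norm (y t \<omega> i)"]
            by (simp, linarith)
          ultimately have yV: "norm (y t \<omega> i) \<le> 1 + V t \<omega>" by linarith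
          have "norm (?f \<omega>) \<le> \<bar>obs_row H i k \<bullet> y t \<omega> i\<bar>" by (auto simp: indicator_def)
          also have "\<dots> \<le> norm (obs_row H i k) * norm (y t \<omega> i)" by (rule Cauchy_Schwarz_ineq2)
          also have "\<dots> \<le> norm (obs_row H i k) * (1 + V t \<omega>)" by (intro mult_left_mono yV) simp
          finally show "norm (?f \<omega>) \<le> norm (norm (obs_row H i k) * (1 + V t \<omega>))"
            using V_nonneg[of t \<omega>] by (simp add: abs_mult)
        qed
      qed
      from past_times_centred[OF ind f[unfolded F_def] this proj[OF ik]] zero_mean[OF ik, of t]
      show ?thesis by (simp add: vW[OF ik, symmetric])
    qed
    have eq: "(\<lambda>\<omega>. indicator B \<omega> * Z t \<omega>)
      = (\<lambda>\<omega>. \<Sum>i<N. \<Sum>k<m i. (indicator B \<omega> * (obs_row H i k \<bullet> y t \<omega> i)) * v t i k \<omega>)"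
      by (simp add: Z_def sum_distrib_left mult.assoc)
    show "integrable M (\<lambda>\<omega>. indicator B \<omega> * Z t \<omega>)"
      unfolding eq by (intro Bochner_Integration.integrable_sum) (use t1 in auto)
    show "expectation (\<lambda>\<omega>. indicator B \<omega> * Z t \<omega>) = 0"
    proof -
      have "expectation (\<lambda>\<omega>. indicator B \<omega> * Z t \<omega>)
        = (\<Sum>i<N. expectation (\<lambda>\<omega>. \<Sum>k<m i. (indicator B \<omega> * (obs_row H i k \<bullet> y t \<omega> i)) * v t i k \<omega>))"
        unfolding eq by (intro Bochner_Integration.integral_sum Bochner_Integration.integrable_sum) (use t1 in auto)
      also have "\<dots> = (\<Sum>i<N. \<Sum>k<m i. expectation (\<lambda>\<omega>. (indicator B \<omega> * (obs_row H i k \<bullet> y t \<omega> i)) * v t i k \<omega>))"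
        by (intro sum.cong refl Bochner_Integration.integral_sum) (use t1 in auto)
      also have "\<dots> = 0" using t1 by (intro sum.neutral ballI) auto
      finally show ?thesis .
    qed
  qed
  have R_int: "integrable M (R t)" "expectation (R t) \<le> \<sigma>" for t
    using square[of t] by (simp_all add: R_def[abs_def])
  have V_int: "integrable M (V t)" for t
  proof (induction t)
    case 0 then show ?case by (simp add: V_def p_def)
  next
    case (Suc t)
    have sp: "space M \<in> sets (F t)" using sets.top[of "F t"] by (simp add: F_def)
    have "integrable M (\<lambda>\<omega>. indicator (space M) \<omega> * Z t \<omega>)" by (rule Z_centred(1)[OF Suc sp])
    then have Zi: "integrable M (Z t)"
      by (rule Bochner_Integration.integrable_cong[THEN iffD1, rotated 2]) auto
    show ?case
    proof (rule Bochner_Integration.integrable_bound)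
      show "integrable M (\<lambda>\<omega>. (1 - c * \<alpha> t) * V t \<omega> + 2 * \<alpha> t * Z t \<omega> + (\<alpha> t)\<^sup>2 * C * R t \<omega>)"
        using Zi Suc R_int by auto
      show "V (Suc t) \<in> borel_measurable M" by (rule toM[OF V_past])
      show "AE \<omega> in M. norm (V (Suc t) \<omega>) \<le> norm ((1 - c * \<alpha> t) * V t \<omega> + 2 * \<alpha> t * Z t \<omega> + (\<alpha> t)\<^sup>2 * C * R t \<omega>)"
      proof (rule AE_I2)
        fix \<omega>
        show "norm (V (Suc t) \<omega>) \<le> norm ((1 - c * \<alpha> t) * V t \<omega> + 2 * \<alpha> t * Z t \<omega> + (\<alpha> t)\<^sup>2 * C * R t \<omega>)"
          using V_Suc[of t \<omega>] V_nonneg[of "Suc t" \<omega>] by simp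
      qed
    qed
  qed
  have step: "(\<integral>\<omega>. indicator B \<omega> * V (Suc t) \<omega> \<partial>M)
      \<le> (1 - c * \<alpha> t) * (\<integral>\<omega>. indicator B \<omega> * V t \<omega> \<partial>M) + (\<alpha> t)\<^sup>2 * C * \<sigma>"
    if B: "B \<in> sets (F t)" for t B
  proof -
    have BM: "B \<in> sets M"
    proof -
      have "indicator B \<in> borel_measurable (F t)" using B by simp
      then have "(indicator B :: 'a \<Rightarrow> real) \<in> borel_measurable M" by (rule toM)
      then show ?thesis using sets.sets_into_space[OF B]
        by (simp add: borel_measurable_indicator_iff F_def Int_absorb1 Int_absorb2)
    qed
    have BV: "integrable M (\<lambda>\<omega>. indicator B \<omega> * V s \<omega>)" for s
      using integrable_mult_indicator[OF BM V_int[of s]] by simp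
    have BR: "integrable M (\<lambda>\<omega>. indicator B \<omega> * R t \<omega>)"
      using integrable_mult_indicator[OF BM R_int(1)[of t]] by simp
    have "(\<integral>\<omega>. indicator B \<omega> * R t \<omega> \<partial>M) \<le> expectation (R t)"
      by (intro integral_mono BR R_int) (auto simp: indicator_def R_def intro!: sum_nonneg)
    then have BR': "(\<integral>\<omega>. indicator B \<omega> * R t \<omega> \<partial>M) \<le> \<sigma>" using R_int(2)[of t] by simp
    have "(\<integral>\<omega>. indicator B \<omega> * V (Suc t) \<omega> \<partial>M)
      \<le> (\<integral>\<omega>. (1 - c * \<alpha> t) * (indicator B \<omega> * V t \<omega>) + 2 * \<alpha> t * (indicator B \<omega> * Z t \<omega>)
            + (\<alpha> t)\<^sup>2 * C * (indicator B \<omega> * R t \<omega>) \<partial>M)"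
    proof (intro integral_mono Bochner_Integration.integrable_add integrable_mult_right BV BR Z_centred(1)[OF V_int B])
      fix \<omega>
      show "indicator B \<omega> * V (Suc t) \<omega> \<le> (1 - c * \<alpha> t) * (indicator B \<omega> * V t \<omega>) + 2 * \<alpha> t * (indicator B \<omega> * Z t \<omega>)
            + (\<alpha> t)\<^sup>2 * C * (indicator B \<omega> * R t \<omega>)"
        using V_Suc[of t \<omega>] by (cases "\<omega> \<in> B") auto
    qed
    also have "\<dots> = (1 - c * \<alpha> t) * (\<integral>\<omega>. indicator B \<omega> * V t \<omega> \<partial>M)
            + (\<alpha> t)\<^sup>2 * C * (\<integral>\<omega>. indicator B \<omega> * R t \<omega> \<partial>M)"
      by (simp add: BV BR Z_centred[OF V_int B])
    also have "\<dots> \<le> (1 - c * \<alpha> t) * (\<integral>\<omega>. indicator B \<omega> * V t \<omega> \<partial>M) + (\<alpha> t)\<^sup>2 * C * \<sigma>"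
      using C(1) by (intro add_left_mono mult_left_mono BR') auto
    finally show ?thesis .
  qed
  have \<sigma>: "0 \<le> \<sigma>"
    using R_int(2)[of 0] by (rule order_trans[rotated]) (auto intro!: integral_nonneg_AE AE_I2 sum_nonneg simp: R_def)
  have \<alpha>0: "\<alpha> \<longlonglongrightarrow> 0"
    using tendsto_real_sqrt[OF summable_LIMSEQ_zero[OF sum(2)]] \<alpha>(1) by simp
  have mean: "(\<lambda>t. expectation (V t)) \<longlonglongrightarrow> 0"
  \<comment> \<open>The choice of \<eta> solves \<open>c * \<alpha> t * \<eta> t = (\<alpha>
    t)\<^sup>2 * C * \<sigma>\<close>.\<close>
  proof (rule perturbed_contraction_tendsto_zero[where T = 0 and a = "\<lambda>t. c * \<alpha> t" and \<eta> = "\<lambda>t. \<alpha> t * (C * \<sigma> / c)"])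
    fix t
    show "0 \<le> expectation (V t)" by (intro integral_nonneg_AE) (auto simp: V_nonneg)
    have sp: "space M \<in> sets (F t)" using sets.top[of "F t"] by (simp add: F_def)
    have e: "(\<integral>\<omega>. indicator (space M) \<omega> * V s \<omega> \<partial>M) = expectation (V s)" for s
      by (intro Bochner_Integration.integral_cong) auto
    show "expectation (V (Suc t)) \<le> (1 - c * \<alpha> t) * expectation (V t) + c * \<alpha> t * (\<alpha> t * (C * \<sigma> / c))"
      using step[OF sp, unfolded e] c by (simp add: power2_eq_square mult_ac)
    show "0 \<le> c * \<alpha> t" "c * \<alpha> t \<le> 1" using c \<alpha> by auto
  next
    show "\<not> summable (\<lambda>t. c * \<alpha> t)" using sum(1) c by simp
    show "(\<lambda>t. \<alpha> t * (C * \<sigma> / c)) \<longlonglongrightarrow> 0" using tendsto_mult_left_zero[OF \<alpha>0] .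
  qed
  have "AE \<omega> in M. (\<lambda>t. V t \<omega>) \<longlonglongrightarrow> 0"
  proof (rule near_supermartingale_AE_tendsto_zero[where s = "\<lambda>t. (\<alpha> t)\<^sup>2 * C * \<sigma>", OF V_int V_nonneg _ _ _ mean])
    fix t0 t :: nat and l :: real assume "t0 \<le> t"
    let ?B = "{\<omega>\<in>space M. \<forall>s\<in>{t0..t}. V s \<omega> < l}"
    have Vs: "V s \<in> borel_measurable (F t)" if "s \<le> t" for s
      using past_mono[OF W that] V_past[of s] by (auto simp: F_def)
    have "{\<omega>\<in>space (F t). \<forall>s\<in>{t0..t}. V s \<omega> < l} \<in> sets (F t)"
      by (rule sets.sets_Collect_finite_All) (use Vs in \<open>auto intro!: borel_measurable_less\<close>)
    then have B: "?B \<in> sets (F t)" by (simp add: F_def)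
    \<comment> \<open>Here the contraction factor is merely bounded by 1; the summable remainder is
      the defect.\<close>
    have "0 \<le> (\<integral>\<omega>. indicator ?B \<omega> * V t \<omega> \<partial>M)"
      by (intro integral_nonneg_AE) (auto simp: V_nonneg)
    then have "(1 - c * \<alpha> t) * (\<integral>\<omega>. indicator ?B \<omega> * V t \<omega> \<partial>M) \<le> 1 * (\<integral>\<omega>. indicator ?B \<omega> * V t \<omega> \<partial>M)"
      using c \<alpha> by (intro mult_right_mono) auto
    then show "(\<integral>\<omega>. indicator ?B \<omega> * V (Suc t) \<omega> \<partial>M)
      \<le> (\<integral>\<omega>. indicator ?B \<omega> * V t \<omega> \<partial>M) + (\<alpha> t)\<^sup>2 * C * \<sigma>"
      using step[OF B] by simp
  next
    show "summable (\<lambda>t. (\<alpha> t)\<^sup>2 * C * \<sigma>)" by (intro summable_mult2 sum(2))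
    show "0 \<le> (\<alpha> t)\<^sup>2 * C * \<sigma>" for t using C(1) \<sigma> by simp
  qed
  then show ?thesis by (simp add: V_def p_def)
qed

section \<open>The event-triggered estimator\<close>

lemma drift_diff:
  "drift N A H m \<alpha> \<beta> (\<lambda>i. e i - f i) i = drift N A H m \<alpha> \<beta> e i - drift N A H m \<alpha> \<beta> f i"
proof -
  have nb: "(\<Sum>j\<in>neighbors N A i. (e i - f i) - (e j - f j))
    = (\<Sum>j\<in>neighbors N A i. e i - e j) - (\<Sum>j\<in>neighbors N A i. f i - f j)"
    unfolding sum_subtractf[symmetric] by (intro sum.cong) auto
  have ob: "(\<Sum>k<m i. (obs_row H i k \<bullet> (e i - f i)) *\<^sub>R obs_row H i k)
    = (\<Sum>k<m i. (obs_row H i k \<bullet> e i) *\<^sub>R obs_row H i k) - (\<Sum>k<m i. (obs_row H i k \<bullet> f i) *\<^sub>R obs_row H i k)"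
    by (simp add: inner_diff_right scaleR_left_diff_distrib sum_subtractf)
  show ?thesis unfolding drift_def nb ob scaleR_diff_right by (rule add_diff_add[symmetric])
qed

text \<open>After the test at time \<open>t\<close>, either the current state has just been sent and
  the gap is 0, or the test failed, which is the bound. At time 0 both states are
  \<open>x0\<close>.\<close>

lemma trigger_gap_le:
  "norm (snd (est_state N A H m \<alpha> \<beta> \<rho> x0 obs t) i - fst (est_state N A H m \<alpha> \<beta> \<rho> x0 obs t) i)
    \<le> 1 / (real t + 1) powr \<rho> i"
  by (cases t) (auto simp: Let_def split_beta norm_minus_commute)

text \<open>The innovation equals the noise minus the observed error. Adding and subtracting the
  true neighbor states splits the consensus term into the Laplacian part of the drift and the
  trigger gaps.\<close>

lemma est_error_Suc:
  fixes \<theta> :: "real^'n::finite"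
  assumes st: "st = est_state N A H m \<alpha> \<beta> \<rho> x0 (\<lambda>t i k. Hmul H i \<theta> k + w t i k)"
  shows "fst (st (Suc t)) i - \<theta> =
    (fst (st t) i - \<theta>) - drift N A H m (\<alpha> t) (\<beta> t) (\<lambda>i. fst (st t) i - \<theta>) i
    + \<alpha> t *\<^sub>R (\<Sum>k<m i. w t i k *\<^sub>R obs_row H i k)
    + \<beta> t *\<^sub>R (\<Sum>j\<in>neighbors N A i. snd (st t) j - fst (st t) j)"
proof -
  let ?x = "fst (st t)" and ?h = "snd (st t)"
  have upd: "fst (st (Suc t)) i = ?x i
     + \<alpha> t *\<^sub>R (\<Sum>k<m i. (Hmul H i \<theta> k + w t i k - Hmul H i (?x i) k) *\<^sub>R obs_row H i k)
     + \<beta> t *\<^sub>R (\<Sum>j\<in>neighbors N A i. ?h j - ?x i)"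
    by (simp add: st Let_def split_beta HTmul_eq_sum)
  have ob: "(\<Sum>k<m i. (Hmul H i \<theta> k + w t i k - Hmul H i (?x i) k) *\<^sub>R obs_row H i k)
    = (\<Sum>k<m i. w t i k *\<^sub>R obs_row H i k) - (\<Sum>k<m i. (obs_row H i k \<bullet> (?x i - \<theta>)) *\<^sub>R obs_row H i k)"
    unfolding sum_subtractf[symmetric]
    by (intro sum.cong) (auto simp: Hmul_eq_inner inner_diff_right algebra_simps)
  have nb: "(\<Sum>j\<in>neighbors N A i. ?h j - ?x i)
    = (\<Sum>j\<in>neighbors N A i. ?h j - ?x j) - (\<Sum>j\<in>neighbors N A i. (?x i - \<theta>) - (?x j - \<theta>))"
    unfolding sum_subtractf[symmetric] by (intro sum.cong) auto
  show ?thesis unfolding drift_def upd ob nb scaleR_diff_right by (simp add: algebra_simps)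
qed

text \<open>A statement about a single path. From time \<open>T\<close> on, \<open>q = e - p\<close>
  obeys the contraction with the trigger gaps as its only forcing, and these are a vanishing
  multiple of \<alpha>.\<close>

lemma est_tendsto_if_noise_error_tendsto:
  fixes \<theta> :: "real^'n::finite"
  assumes contr: "\<And>t e. T \<le> t \<Longrightarrow> (\<Sum>i<N. (norm (e i - drift N A H m (\<alpha> t) (\<beta> t) e i))\<^sup>2)
        \<le> (1 - c * \<alpha> t) * (\<Sum>i<N. (norm (e i))\<^sup>2)"
    and c: "c > 0" and steps: "\<And>t. 0 \<le> \<alpha> t" "\<And>t. 0 \<le> \<beta> t" "\<And>t. T \<le> t \<Longrightarrow> c * \<alpha> t \<le> 1"
    and div: "\<not> summable \<alpha>"
    and trigger: "\<And>t i. i < N \<Longrightarrow> \<beta> t / (real t + 1) powr \<rho> i \<le> \<alpha> t * \<eta> t" "\<eta> \<longlonglongrightarrow> 0"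
    and noise: "(\<lambda>t. \<Sum>i<N. (norm (noise_error N A H m (\<lambda>t. if t < T then 0 else \<alpha> t)
        (\<lambda>t. if t < T then 0 else \<beta> t) w t i))\<^sup>2) \<longlonglongrightarrow> 0"
    and i: "i < N"
  shows "(\<lambda>t. est N A H m \<alpha> \<beta> \<rho> x0 (\<lambda>t i k. Hmul H i \<theta> k + w t i k) t i) \<longlonglongrightarrow> \<theta>"
proof -
  define st where "st = est_state N A H m \<alpha> \<beta> \<rho> x0 (\<lambda>t i k. Hmul H i \<theta> k + w t i k)"
  define e where "e t i = fst (st t) i - \<theta>" for t i
  define p where "p = noise_error N A H m (\<lambda>t. if t < T then 0 else \<alpha> t) (\<lambda>t. if t < T then 0 else \<beta> t) w"
  define q where "q t i = e t i - p t i" for t i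
  define d where "d t i = (\<Sum>j\<in>neighbors N A i. snd (st t) j - fst (st t) j)" for t i
  \<comment> \<open>The norm and not its square, so that the gaps enter additively by the triangle
    inequality.\<close>
  define Q where "Q t = L2_set (\<lambda>i. norm (q t i)) {..<N}" for t
  have q_Suc: "q (Suc t) i = (q t i - drift N A H m (\<alpha> t) (\<beta> t) (q t) i) + \<beta> t *\<^sub>R d t i" if "T \<le> t" for t i
  proof -
    have "drift N A H m (\<alpha> t) (\<beta> t) (q t) i = drift N A H m (\<alpha> t) (\<beta> t) (e t) i - drift N A H m (\<alpha> t) (\<beta> t) (p t) i"
      unfolding q_def by (rule drift_diff)
    moreover have "e (Suc t) i = e t i - drift N A H m (\<alpha> t) (\<beta> t) (e t) i
        + \<alpha> t *\<^sub>R (\<Sum>k<m i. w t i k *\<^sub>R obs_row H i k) + \<beta> t *\<^sub>R d t i"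
      unfolding e_def d_def by (rule est_error_Suc[OF st_def])
    moreover have "p (Suc t) i = p t i - drift N A H m (\<alpha> t) (\<beta> t) (p t) i
        + \<alpha> t *\<^sub>R (\<Sum>k<m i. w t i k *\<^sub>R obs_row H i k)"
      using that by (simp add: p_def)
    ultimately show ?thesis by (simp add: q_def)
  qed
  have d: "norm (\<beta> t *\<^sub>R d t i) \<le> real N * (\<alpha> t * \<eta> t)" if "i < N" for t i
  proof -
    \<comment> \<open>No sign is assumed for \<eta>; the trigger bound makes the product
      nonnegative.\<close>
    have ge: "0 \<le> \<alpha> t * \<eta> t"
      using trigger(1)[OF that, of t] steps(2)[of t] by (smt (verit) divide_nonneg_nonneg powr_ge_zero)
    have "norm (\<beta> t *\<^sub>R d t i) \<le> \<beta> t * (\<Sum>j\<in>neighbors N A i. norm (snd (st t) j - fst (st t) j))"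
      using steps(2)[of t] by (auto simp: d_def intro!: mult_left_mono norm_sum)
    also have "\<dots> = (\<Sum>j\<in>neighbors N A i. \<beta> t * norm (snd (st t) j - fst (st t) j))"
      by (simp add: sum_distrib_left)
    also have "\<dots> \<le> (\<Sum>j\<in>neighbors N A i. \<alpha> t * \<eta> t)"
    proof (rule sum_mono)
      fix j assume "j \<in> neighbors N A i"
      then have j: "j < N" by (rule neighbors_less)
      have "\<beta> t * norm (snd (st t) j - fst (st t) j) \<le> \<beta> t * (1 / (real t + 1) powr \<rho> j)"
        unfolding st_def by (intro mult_left_mono trigger_gap_le steps)
      also have "\<dots> \<le> \<alpha> t * \<eta> t" using trigger(1)[OF j, of t] by simp
      finally show "\<beta> t * norm (snd (st t) j - fst (st t) j) \<le> \<alpha> t * \<eta> t" .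
    qed
    also have "\<dots> = real (card (neighbors N A i)) * (\<alpha> t * \<eta> t)" by simp
    also have "\<dots> \<le> real N * (\<alpha> t * \<eta> t)"
      using card_mono[of "{..<N}" "neighbors N A i"] ge
      by (intro mult_right_mono) (auto simp: neighbors_def)
    finally show ?thesis .
  qed
  have Q_Suc: "Q (Suc t) \<le> (1 - c / 2 * \<alpha> t) * Q t + c / 2 * \<alpha> t * (2 * real N * real N / c * \<eta> t)" if t: "T \<le> t" for t
  proof -
    let ?y = "\<lambda>i. q t i - drift N A H m (\<alpha> t) (\<beta> t) (q t) i"
    have "Q (Suc t) \<le> L2_set (\<lambda>i. norm (?y i) + norm (\<beta> t *\<^sub>R d t i)) {..<N}"
      unfolding Q_def q_Suc[OF t] by (intro L2_set_mono norm_triangle_ineq) auto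
    also have "\<dots> \<le> L2_set (\<lambda>i. norm (?y i)) {..<N} + L2_set (\<lambda>i. norm (\<beta> t *\<^sub>R d t i)) {..<N}"
      by (rule L2_set_triangle_ineq)
    also have "L2_set (\<lambda>i. norm (\<beta> t *\<^sub>R d t i)) {..<N} \<le> (\<Sum>i<N. norm (\<beta> t *\<^sub>R d t i))"
      by (rule L2_set_le_sum) auto
    also have "\<dots> \<le> (\<Sum>i<N. real N * (\<alpha> t * \<eta> t))"
      by (intro sum_mono d) auto
    \<comment> \<open>Taking square roots halves the rate, since
      \<open>1 - c * \<alpha> t \<le> (1 - c / 2 * \<alpha> t)\<^sup>2\<close>.\<close>
    also have "L2_set (\<lambda>i. norm (?y i)) {..<N} \<le> (1 - c / 2 * \<alpha> t) * Q t"
    proof -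
      have s: "0 \<le> 1 - c / 2 * \<alpha> t" 
        using steps(3)[OF t] mult_nonneg_nonneg[OF less_imp_le[OF c] steps(1)[of t]] by simp
      have "(\<Sum>i<N. (norm (?y i))\<^sup>2) \<le> (1 - c * \<alpha> t) * (\<Sum>i<N. (norm (q t i))\<^sup>2)"
        by (rule contr[OF t])
      also have "\<dots> \<le> (1 - c / 2 * \<alpha> t)\<^sup>2 * (\<Sum>i<N. (norm (q t i))\<^sup>2)"
        by (intro mult_right_mono sum_nonneg) (auto simp: power2_diff)
      finally have "sqrt (\<Sum>i<N. (norm (?y i))\<^sup>2) \<le> sqrt ((1 - c / 2 * \<alpha> t)\<^sup>2 * (\<Sum>i<N. (norm (q t i))\<^sup>2))"
        by (rule real_sqrt_le_mono)
      then show ?thesis using s by (simp add: L2_set_def Q_def real_sqrt_mult)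
    qed
    finally show ?thesis using c by (simp add: mult_ac)
  qed
  have "Q \<longlonglongrightarrow> 0"
  proof (rule perturbed_contraction_tendsto_zero[where a = "\<lambda>t. c / 2 * \<alpha> t" and \<eta> = "\<lambda>t. 2 * real N * real N / c * \<eta> t", OF _ Q_Suc])
    show "0 \<le> Q t" for t by (simp add: Q_def)
    show "0 \<le> c / 2 * \<alpha> t" for t using c steps(1) by simp
    show "c / 2 * \<alpha> t \<le> 1" if "T \<le> t" for t
      using steps(3)[OF that] mult_nonneg_nonneg[OF less_imp_le[OF c] steps(1)[of t]] by simp
    show "\<not> summable (\<lambda>t. c / 2 * \<alpha> t)" using div c by simp
    show "(\<lambda>t. 2 * real N * real N / c * \<eta> t) \<longlonglongrightarrow> 0" using tendsto_mult_right_zero[OF trigger(2)] .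
  qed
  moreover have "(\<lambda>t. sqrt (\<Sum>i<N. (norm (p t i))\<^sup>2)) \<longlonglongrightarrow> sqrt 0"
    using noise unfolding p_def by (intro tendsto_real_sqrt)
  ultimately have lim: "(\<lambda>t. Q t + L2_set (\<lambda>i. norm (p t i)) {..<N}) \<longlonglongrightarrow> 0"
    using tendsto_add by (fastforce simp: L2_set_def)
  have "norm (e t i) \<le> Q t + L2_set (\<lambda>i. norm (p t i)) {..<N}" for t
  proof -
    have "norm (q t i) \<le> Q t" unfolding Q_def
      by (rule member_le_L2_set) (use i in auto)
    moreover have "norm (p t i) \<le> L2_set (\<lambda>i. norm (p t i)) {..<N}"
      by (rule member_le_L2_set) (use i in auto)
    moreover have "norm (e t i) \<le> norm (q t i) + norm (p t i)"
      using norm_triangle_ineq[of "q t i" "p t i"] by (simp add: q_def)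
    ultimately show ?thesis by linarith
  qed
  then have "(\<lambda>t. e t i) \<longlonglongrightarrow> 0"
    by (intro Lim_null_comparison[OF _ lim]) auto
  then show ?thesis by (simp add: e_def st_def est_def LIM_zero_iff)
qed

section \<open>Power-law step sizes\<close>

lemma summable_inverse_powr_iff:
  assumes "a > 0"
  shows "summable (\<lambda>t. a / (real t + 1) powr s) \<longleftrightarrow> s > 1"
proof -
  have "(\<lambda>t. a / (real t + 1) powr s) = (\<lambda>t. a * real (Suc t) powr (- s))"
    by (simp add: powr_minus_divide add.commute)
  moreover have "summable (\<lambda>t. a * real (Suc t) powr (- s)) \<longleftrightarrow> summable (\<lambda>t. real (Suc t) powr (- s))"
    using assms by simp
  moreover have "\<dots> \<longleftrightarrow> summable (\<lambda>t. real t powr (- s))"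
    using summable_Suc_iff[of "\<lambda>t. real t powr (- s)"] .
  moreover have "\<dots> \<longleftrightarrow> s > 1" by (simp add: summable_real_powr_iff)
  ultimately show ?thesis by metis
qed

lemma inverse_powr_tendsto_zero:
  assumes "s > 0"
  shows "(\<lambda>t. a / (real t + 1) powr s) \<longlonglongrightarrow> 0"
proof -
  have "filterlim (\<lambda>t. real t + 1) at_top sequentially"
    by (rule filterlim_at_top_mono[OF filterlim_real_sequentially]) auto
  then have "(\<lambda>t. (real t + 1) powr (- s)) \<longlonglongrightarrow> 0"
    by (intro tendsto_neg_powr) (use assms in auto)
  from tendsto_mult_right_zero[OF this, of a] show ?thesis by (simp add: powr_minus_divide)
qed

section \<open>Second moments of the stacked noise\<close>

lemma stacked_norm_power2: "(stacked_norm N m v \<omega>)\<^sup>2 = (\<Sum>i<N. \<Sum>k<m i. (v i k \<omega>)\<^sup>2)"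
proof -
  have "(\<Sum>(i,k)\<in>noise_idx N m. (v i k \<omega>)\<^sup>2) = (\<Sum>i<N. \<Sum>k<m i. (v i k \<omega>)\<^sup>2)"
    unfolding noise_idx_def by (rule sum.Sigma[symmetric]) auto
  then show ?thesis by (simp add: stacked_norm_def sum_nonneg)
qed

text \<open>For \<open>x \<ge> 0\<close> one has
  \<open>x\<^sup>2 \<le> 1 + x powr (2 + \<epsilon>)\<close>, and the right-hand side is integrable
  on a probability space.\<close>

lemma (in prob_space) stacked_square_integrable:
  assumes meas: "\<And>i k. i < N \<Longrightarrow> k < m i \<Longrightarrow> v i k \<in> borel_measurable M"
    and "\<epsilon> > 0" and moment: "(\<integral>\<^sup>+ \<omega>. ennreal (stacked_norm N m v \<omega> powr (2 + \<epsilon>)) \<partial>M) < \<infinity>"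
  shows "integrable M (\<lambda>\<omega>. \<Sum>i<N. \<Sum>k<m i. (v i k \<omega>)\<^sup>2)"
proof (rule Bochner_Integration.integrable_bound)
  have sq: "(\<lambda>\<omega>. \<Sum>i<N. \<Sum>k<m i. (v i k \<omega>)\<^sup>2) \<in> borel_measurable M"
    using meas by (intro borel_measurable_sum borel_measurable_power) auto
  then show "(\<lambda>\<omega>. \<Sum>i<N. \<Sum>k<m i. (v i k \<omega>)\<^sup>2) \<in> borel_measurable M" .
  have nn: "0 \<le> stacked_norm N m v \<omega>" for \<omega>
    unfolding stacked_norm_def by (intro real_sqrt_ge_zero sum_nonneg) auto
  have sn: "stacked_norm N m v \<omega> = sqrt (\<Sum>i<N. \<Sum>k<m i. (v i k \<omega>)\<^sup>2)" for \<omega>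
    using nn[of \<omega>] by (simp flip: stacked_norm_power2)
  have "(\<lambda>\<omega>. stacked_norm N m v \<omega> powr (2 + \<epsilon>)) \<in> borel_measurable M"
    unfolding sn using sq by measurable
  then have "integrable M (\<lambda>\<omega>. stacked_norm N m v \<omega> powr (2 + \<epsilon>))"
    using moment by (intro integrableI_nonneg) auto
  then show "integrable M (\<lambda>\<omega>. 1 + stacked_norm N m v \<omega> powr (2 + \<epsilon>))" by simp
  show "AE \<omega> in M. norm (\<Sum>i<N. \<Sum>k<m i. (v i k \<omega>)\<^sup>2) \<le> norm (1 + stacked_norm N m v \<omega> powr (2 + \<epsilon>))"
  proof (rule AE_I2)
    fix \<omega>
    have "(stacked_norm N m v \<omega>)\<^sup>2 \<le> 1 + stacked_norm N m v \<omega> powr (2 + \<epsilon>)"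
    proof (cases "stacked_norm N m v \<omega> \<le> 1")
      case True
      then have "(stacked_norm N m v \<omega>)\<^sup>2 \<le> 1" using nn[of \<omega>] by (simp add: power_le_one)
      then show ?thesis by (simp add: add_increasing2)
    next
      case False
      then have "stacked_norm N m v \<omega> powr 2 \<le> stacked_norm N m v \<omega> powr (2 + \<epsilon>)"
        using \<open>\<epsilon> > 0\<close> by (intro powr_mono) auto
      then show ?thesis using False by (simp add: powr_numeral)
    qed
    then show "norm (\<Sum>i<N. \<Sum>k<m i. (v i k \<omega>)\<^sup>2) \<le> norm (1 + stacked_norm N m v \<omega> powr (2 + \<epsilon>))"
      unfolding stacked_norm_power2 by (simp add: sum_nonneg)
  qed
qed

text \<open>The second moment depends only on the law of the stacked noise, so identical
  distribution yields one bound for all times.\<close>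

lemma expectation_square_stacked:
  fixes N :: nat and m :: "nat \<Rightarrow> nat" and v :: "nat \<Rightarrow> nat \<Rightarrow> 'a \<Rightarrow> real"
  defines "S \<equiv> PiM (noise_idx N m) (\<lambda>_. borel :: real measure)"
  assumes meas: "stacked N m v \<in> measurable M S"
  shows "integral\<^sup>L M (\<lambda>\<omega>. \<Sum>i<N. \<Sum>k<m i. (v i k \<omega>)\<^sup>2)
    = integral\<^sup>L (distr M S (stacked N m v)) (\<lambda>f. \<Sum>i<N. \<Sum>k<m i. (f (i, k))\<^sup>2)"
proof -
  have "(\<lambda>f. \<Sum>i<N. \<Sum>k<m i. (f (i, k))\<^sup>2) \<in> borel_measurable S"
    unfolding S_def
    by (intro borel_measurable_sum borel_measurable_power measurable_component_singleton)
      (auto simp: noise_idx_def)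
  then show ?thesis
    by (subst integral_distr[OF meas])
      (auto intro!: Bochner_Integration.integral_cong sum.cong simp: stacked_def noise_idx_def)
qed

section \<open>Strong consistency of the event-triggered estimator\<close>

theorem theorem3:
  fixes M :: "'w measure"
    and N :: nat and A :: "nat \<Rightarrow> nat \<Rightarrow> bool"
    and m :: "nat \<Rightarrow> nat" and H :: "nat \<Rightarrow> nat \<Rightarrow> 'n::finite \<Rightarrow> real"
    and \<theta> :: "real^'n" and v :: "nat \<Rightarrow> nat \<Rightarrow> nat \<Rightarrow> 'w \<Rightarrow> real"
    and \<rho> :: "nat \<Rightarrow> real" and x0 :: "nat \<Rightarrow> real^'n"
    and a b \<tau>1 \<tau>2 \<epsilon>1 :: real
  assumes P: "prob_space M"
    and graph: "undirected_graph N A"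
    and conn: "graph_connected N A"
    and full_rank: "invertible (Gram N H m)"
    and meas: "\<And>t i k. i < N \<Longrightarrow> k < m i \<Longrightarrow> v t i k \<in> borel_measurable M"
    and zero_mean: "\<And>t i k. i < N \<Longrightarrow> k < m i \<Longrightarrow>
                      integrable M (v t i k) \<and> integral\<^sup>L M (v t i k) = 0"
    and indep: "prob_space.indep_vars M (\<lambda>_. PiM (noise_idx N m) (\<lambda>_. borel))
                  (\<lambda>t. stacked N m (v t)) UNIV"
    and ident: "\<And>t. distr M (PiM (noise_idx N m) (\<lambda>_. borel)) (stacked N m (v t))
                   = distr M (PiM (noise_idx N m) (\<lambda>_. borel)) (stacked N m (v 0))"
    and eps1: "\<epsilon>1 > 0"
    and moment: "\<And>t. (\<integral>\<^sup>+ \<omega>. ennreal (stacked_norm N m (v t) \<omega> powr (2 + \<epsilon>1)) \<partial>M) < \<infinity>"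
    and ab: "a > 0" "b > 0"
    and taus: "0 < \<tau>2" "\<tau>2 \<le> \<tau>1" "\<tau>1 \<le> 1"
    and tau1_big: "\<tau>1 > max (\<tau>2 + 1 / (2 + \<epsilon>1)) 0.5"
    and rho_pos: "\<And>i. i < N \<Longrightarrow> \<rho> i > 0"
    and rho0: "Min (\<rho> ` {..<N}) > \<tau>1 - \<tau>2"
  shows "\<forall>i<N. AE \<omega> in M.
           (\<lambda>t. est N A H m (\<lambda>t. a / (real t + 1) powr \<tau>1) (\<lambda>t. b / (real t + 1) powr \<tau>2) \<rho> x0
                   (\<lambda>t i k. Hmul H i \<theta> k + v t i k \<omega>) t i) \<longlonglongrightarrow> \<theta>"
proof (cases "N = 0")
  case True then show ?thesis by simp
next
  case False
  interpret prob_space M by (rule P)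
  define \<alpha> where "\<alpha> = (\<lambda>t. a / (real t + 1) powr \<tau>1)"
  define \<beta> where "\<beta> = (\<lambda>t. b / (real t + 1) powr \<tau>2)"
  define \<rho>0 where "\<rho>0 = Min (\<rho> ` {..<N})"
  have \<alpha>0: "0 \<le> \<alpha> t" and \<beta>0: "0 \<le> \<beta> t" for t using ab by (auto simp: \<alpha>_def \<beta>_def)
  \<comment> \<open>From \<open>\<tau>2 \<le> \<tau>1\<close>; \<open>b / a\<close> is the ratio
    \<open>r\<close> passed to \<open>drift_contraction\<close>.\<close>
  have ratio: "b / a * \<alpha> t \<le> \<beta> t" for t
  proof -
    have "(real t + 1) powr \<tau>2 \<le> (real t + 1) powr \<tau>1" using taus by (intro powr_mono) auto
    then show ?thesis using ab by (simp add: \<alpha>_def \<beta>_def field_simps)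
  qed
  obtain c \<kappa> where c: "c > 0" "\<kappa> > 0" "c * \<kappa> \<le> 1"
    and contr: "\<And>\<alpha> \<beta> e. \<lbrakk>0 \<le> \<alpha>; b / a * \<alpha> \<le> \<beta>; \<alpha> \<le> \<kappa>; \<beta> \<le> \<kappa>\<rbrakk> \<Longrightarrow>
       (\<Sum>i<N. (norm (e i - drift N A H m \<alpha> \<beta> e i))\<^sup>2) \<le> (1 - c * \<alpha>) * (\<Sum>i<N. (norm (e i))\<^sup>2)"
    by (rule drift_contraction[OF graph conn full_rank, where r = "b / a"]) (use False ab in auto)
  have "\<alpha> \<longlonglongrightarrow> 0" "\<beta> \<longlonglongrightarrow> 0"
    unfolding \<alpha>_def \<beta>_def by (rule inverse_powr_tendsto_zero, use taus in simp)+
  then have "\<forall>\<^sub>F t in sequentially. \<alpha> t < \<kappa> \<and> \<beta> t < \<kappa>"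
    using c(2) by (auto dest!: order_tendstoD(2) intro: eventually_conj)
  then obtain T where T: "\<And>t. T \<le> t \<Longrightarrow> \<alpha> t < \<kappa> \<and> \<beta> t < \<kappa>"
    by (auto simp: eventually_sequentially)
  have c\<alpha>: "c * \<alpha> t \<le> 1" if "T \<le> t" for t
    using T[OF that] c mult_left_mono[of "\<alpha> t" \<kappa> c] by linarith
  have contrT: "(\<Sum>i<N. (norm (e i - drift N A H m (\<alpha> t) (\<beta> t) e i))\<^sup>2)
        \<le> (1 - c * \<alpha> t) * (\<Sum>i<N. (norm (e i))\<^sup>2)" if "T \<le> t" for t e
    using T[OF that] by (intro contr \<alpha>0 ratio) auto
  \<comment> \<open>Zeroing the early steps keeps the noise error at 0 until time \<open>T\<close> and makes the contraction valid at all times.\<close>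
  define \<alpha>' where "\<alpha>' = (\<lambda>t. if t < T then 0 else \<alpha> t)"
  define \<beta>' where "\<beta>' = (\<lambda>t. if t < T then 0 else \<beta> t)"
  have ev: "\<forall>\<^sub>F t in sequentially. \<alpha>' t = \<alpha> t"
    unfolding eventually_sequentially by (intro exI[of _ T]) (auto simp: \<alpha>'_def)
  \<comment> \<open>\<open>\<tau>1 \<le> 1\<close> gives divergence here, and
    \<open>2 * \<tau>1 > 1\<close> gives summability of the squares below.\<close>
  have div: "\<not> summable \<alpha>"
    unfolding \<alpha>_def using summable_inverse_powr_iff[OF ab(1)] taus by simp
  have div': "\<not> summable \<alpha>'" using div summable_cong[OF ev] by simp
  have sq: "summable (\<lambda>t. (\<alpha> t)\<^sup>2)"
  proof -
    have "(\<lambda>t. (\<alpha> t)\<^sup>2) = (\<lambda>t. a\<^sup>2 / (real t + 1) powr (2 * \<tau>1))"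
      by (simp add: \<alpha>_def power_divide powr_add[symmetric] power2_eq_square)
    then show ?thesis using summable_inverse_powr_iff[of "a\<^sup>2" "2 * \<tau>1"] ab tau1_big by simp
  qed
  have sq': "summable (\<lambda>t. (\<alpha>' t)\<^sup>2)"
  proof -
    have "\<forall>\<^sub>F t in sequentially. (\<alpha>' t)\<^sup>2 = (\<alpha> t)\<^sup>2" using ev by eventually_elim simp
    from summable_cong[OF this] sq show ?thesis by simp
  qed
  have sm: "stacked N m (v t) \<in> measurable M (PiM (noise_idx N m) (\<lambda>_. borel))" for t
    using indep by (auto simp: indep_vars_def)
  have noise: "AE \<omega> in M. (\<lambda>t. \<Sum>i<N. (norm (noise_error N A H m \<alpha>' \<beta>' (\<lambda>t i k. v t i k \<omega>) t i))\<^sup>2) \<longlonglongrightarrow> 0"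
  proof (rule noise_error_AE_tendsto_zero[OF zero_mean indep _ _ _ c(1) _ _ div' sq'])
    show "integrable M (\<lambda>\<omega>. \<Sum>i<N. \<Sum>k<m i. (v t i k \<omega>)\<^sup>2)" for t
      by (rule stacked_square_integrable[OF meas eps1 moment])
    \<comment> \<open>The second moment at time 0 serves as \<sigma>.\<close>
    show "expectation (\<lambda>\<omega>. \<Sum>i<N. \<Sum>k<m i. (v t i k \<omega>)\<^sup>2) \<le> expectation (\<lambda>\<omega>. \<Sum>i<N. \<Sum>k<m i. (v 0 i k \<omega>)\<^sup>2)" for t
      by (simp add: expectation_square_stacked[OF sm] ident[of t])
    show "(\<Sum>i<N. (norm (e i - drift N A H m (\<alpha>' t) (\<beta>' t) e i))\<^sup>2)
        \<le> (1 - c * \<alpha>' t) * (\<Sum>i<N. (norm (e i))\<^sup>2)" for t e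
      using contrT[of t e] by (cases "t < T") (auto simp: \<alpha>'_def \<beta>'_def drift_def)
    show "0 \<le> \<alpha>' t" "c * \<alpha>' t \<le> 1" for t
      using \<alpha>0 c\<alpha>[of t] by (auto simp: \<alpha>'_def)
  qed
  \<comment> \<open>The quotient of \<open>\<beta> t / (real t + 1) powr \<rho>0\<close> by
    \<open>\<alpha> t\<close>; its exponent is positive exactly when
    \<open>\<rho>0 > \<tau>1 - \<tau>2\<close>.\<close>
  define \<eta> where "\<eta> = (\<lambda>t. (b / a) / (real t + 1) powr (\<rho>0 + \<tau>2 - \<tau>1))"
  have \<eta>: "\<eta> \<longlonglongrightarrow> 0"
    unfolding \<eta>_def by (rule inverse_powr_tendsto_zero) (use rho0 in \<open>simp add: \<rho>0_def\<close>)
  have trigger: "\<beta> t / (real t + 1) powr \<rho> i \<le> \<alpha> t * \<eta> t" if i: "i < N" for t i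
  proof -
    have "\<rho>0 \<le> \<rho> i" unfolding \<rho>0_def using i by (intro Min_le) auto
    then have "(real t + 1) powr (\<tau>2 + \<rho>0) \<le> (real t + 1) powr (\<tau>2 + \<rho> i)" by (intro powr_mono) auto
    then have "b / (real t + 1) powr (\<tau>2 + \<rho> i) \<le> b / (real t + 1) powr (\<tau>2 + \<rho>0)"
      using ab by (intro divide_left_mono) auto
    also have "b / (real t + 1) powr (\<tau>2 + \<rho>0) = \<alpha> t * \<eta> t"
    proof -
      have "(real t + 1) powr (\<tau>2 + \<rho>0) = (real t + 1) powr \<tau>1 * (real t + 1) powr (\<rho>0 + \<tau>2 - \<tau>1)"
        by (simp add: powr_add[symmetric] add.commute)
      then show ?thesis using ab by (simp add: \<alpha>_def \<eta>_def)
    qed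
    finally show ?thesis by (simp add: \<beta>_def powr_add)
  qed
  show ?thesis
  proof (intro allI impI)
    fix i assume i: "i < N"
    from noise show "AE \<omega> in M.
           (\<lambda>t. est N A H m (\<lambda>t. a / (real t + 1) powr \<tau>1) (\<lambda>t. b / (real t + 1) powr \<tau>2) \<rho> x0
                   (\<lambda>t i k. Hmul H i \<theta> k + v t i k \<omega>) t i) \<longlonglongrightarrow> \<theta>"
    proof (rule AE_mp, intro AE_I2 impI)
      fix \<omega>
      assume "(\<lambda>t. \<Sum>i<N. (norm (noise_error N A H m \<alpha>' \<beta>' (\<lambda>t i k. v t i k \<omega>) t i))\<^sup>2) \<longlonglongrightarrow> 0"
      from est_tendsto_if_noise_error_tendsto[OF contrT c(1) \<alpha>0 \<beta>0 c\<alpha> div trigger \<eta> this[unfolded \<alpha>'_def \<beta>'_def] i]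
      show "(\<lambda>t. est N A H m (\<lambda>t. a / (real t + 1) powr \<tau>1) (\<lambda>t. b / (real t + 1) powr \<tau>2) \<rho> x0
                   (\<lambda>t i k. Hmul H i \<theta> k + v t i k \<omega>) t i) \<longlonglongrightarrow> \<theta>"
        by (simp add: \<alpha>_def \<beta>_def)
    qed
  qed
qed

end
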